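(* Let $n\ge 1$. For any connected graph $\Gamma_{n+1}$ on $[n+1]$ and all indices $i$ in the respective ranges: 1) $\gamma_i(As^n)\le\gamma_i(P_{\Gamma_{n+1}})\le\gamma_i(Pe^n)$ for $0\le i\le\lfloor n/2\rfloor$; 2) $g_i(As^n)\le g_i(P_{\Gamma_{n+1}})\le g_i(Pe^n)$ for $0\le i\le\lfloor n/2\rfloor$; 3) $h_i(As^n)\le h_i(P_{\Gamma_{n+1}})\le h_i(Pe^n)$ for $0\le i\le n$; 4) $f_i(As^n)\le f_i(P_{\Gamma_{n+1}})\le f_i(Pe^n)$ for $0\le i\le n$.
   Context: Notation: $[m]=\{1,\ldots,m\}$. Graphs are finite, with no loops or multiple edges. For a graph $\Gamma$ on $[n+1]$, the graphical building set $B(\Gamma)$ is the collection of nonempty $S\subseteq[n+1]$ such that the induced subgraph $\Gamma|_S$ is connected. The graph-associahedron is the Minkowski sum $P_\Gamma=\sum_{S\in B(\Gamma)}\Delta^S\subset\mathbb{R}^{n+1}$, where $\Delta^S=\mathrm{conv}\{e_i : i\in S\}$ and $e_1,\ldots,e_{n+1}$ are the standard basis vectors of $\mathbb{R}^{n+1}$. For connected $\Gamma$ on $[n+1]$, $P_\Gamma$ is a simple polytope of dimension $n$ (a polytope of dimension $n$ is simple if every vertex lies in exactly $n$ facets). Special series: $As^n=P_{L_{n+1}}$ (associahedron), $L_{n+1}$ the path graph on $[n+1]$; $Pe^n=P_{K_{n+1}}$ (permutohedron), $K_{n+1}$ the complete graph on $[n+1]$. For an $n$-dimensional simple polytope $P$,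 let $f_i=f_i(P)$ be the number of its $i$-dimensional faces ($f_n=1$), $F(P)(\alpha,t)=\sum_{i=0}^n f_i\alpha^i t^{n-i}$ and $H(P)(\alpha,t)=F(P)(\alpha-t,t)=\sum_{i=0}^n h_i\alpha^{n-i}t^i$, which defines $h_i=h_i(P)$. Put $g_0=1$ and $g_i=h_i-h_{i-1}$ for $1\le i\le\lfloor n/2\rfloor$. By the Dehn–Sommerville equations $H(P)$ is symmetric in $\alpha,t$, so it is uniquely written as $H(P)=\sum_{i=0}^{\lfloor n/2\rfloor}\gamma_i(\alpha t)^i(\alpha+t)^{n-2i}$, which defines $\gamma_i=\gamma_i(P)$. *)

theory Defs
  imports
    "HOL-Analysis.Analysis"
    "HOL-Library.Set_Algebras"
    "HOL-Computational_Algebra.Polynomial"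
    "Graph_Theory.Digraph_Component"
begin

text \<open>
  A simple graph on the vertex set $[n+1]$ is a \<^locale>\<open>pair_graph\<close> (finite, loop-free, with a
  symmetric set of arcs) whose vertices are all elements of a finite linearly ordered type \<open>'v\<close>
  with $n+1$ elements. The linear order only matters for the path graph.
\<close>

definition path_graph :: "'v::linorder pair_pre_digraph" where
  "path_graph = \<lparr>pverts = UNIV,
     parcs = {(i, j). (i < j \<and> {i<..<j} = {}) \<or> (j < i \<and> {j<..<i} = {})}\<rparr>"

definition complete_graph :: "'v pair_pre_digraph" where
  "complete_graph = \<lparr>pverts = UNIV, parcs = {(i, j). i \<noteq> j}\<rparr>"

definition graphical_building_set :: "'v pair_pre_digraph \<Rightarrow> 'v set set" where
  "graphical_building_set \<Gamma> =
     {S. S \<noteq> {} \<and> S \<subseteq> pverts \<Gamma> \<and> Digraph_Component.connected (with_proj \<Gamma> \<restriction> S)}"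

definition face_simplex :: "'v::finite set \<Rightarrow> (real ^ 'v) set" where
  "face_simplex S = convex hull ((\<lambda>i. axis i 1) ` S)"

text \<open>The sum below is the Minkowski sum of sets.\<close>

definition graph_associahedron :: "'v::finite pair_pre_digraph \<Rightarrow> (real ^ 'v) set" where
  "graph_associahedron \<Gamma> = (\<Sum>S\<in>graphical_building_set \<Gamma>. face_simplex S)"

definition associahedron :: "(real ^ 'v::{finite,linorder}) set" where
  "associahedron = graph_associahedron path_graph"

definition permutohedron :: "(real ^ 'v::finite) set" where
  "permutohedron = graph_associahedron complete_graph"

definition poly_dim :: "'a::euclidean_space set \<Rightarrow> nat" where
  "poly_dim P = nat (aff_dim P)"

definition f_num :: "'a::euclidean_space set \<Rightarrow> nat \<Rightarrow> nat" where
  "f_num P i = card {F. F face_of P \<and> aff_dim F = int i}"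

text \<open>
  Bivariate polynomials in $\alpha$ and $t$ are elements of \<^typ>\<open>int poly poly\<close>: the outer
  variable is $\alpha$, the coefficients are polynomials in $t$.
\<close>

definition alpha_var :: "int poly poly" where
  "alpha_var = [:0, 1:]"

definition t_var :: "int poly poly" where
  "t_var = [:[:0, 1:]:]"

definition F_poly :: "'a::euclidean_space set \<Rightarrow> int poly poly" where
  "F_poly P = (\<Sum>i\<le>poly_dim P. of_nat (f_num P i) * alpha_var ^ i * t_var ^ (poly_dim P - i))"

text \<open>Composition substitutes $\alpha - t$ for the outer variable $\alpha$ and leaves $t$ unchanged.\<close>

definition H_poly :: "'a::euclidean_space set \<Rightarrow> int poly poly" where
  "H_poly P = pcompose (F_poly P) (alpha_var - t_var)"

text \<open>The coefficient of $\alpha^{n-i} t^i$ in $H(P)$, where $n = \dim P$; meaningful for $i \le n$.\<close>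

definition h_num :: "'a::euclidean_space set \<Rightarrow> nat \<Rightarrow> int" where
  "h_num P i = coeff (coeff (H_poly P) (poly_dim P - i)) i"

definition g_num :: "'a::euclidean_space set \<Rightarrow> nat \<Rightarrow> int" where
  "g_num P i = (if i = 0 then 1 else h_num P i - h_num P (i - 1))"

text \<open>
  The unique coefficient sequence, padded with zeros beyond $\lfloor n/2 \rfloor$. It exists for
  every simple polytope because of the Dehn--Sommerville equations.
\<close>

definition gamma_num :: "'a::euclidean_space set \<Rightarrow> nat \<Rightarrow> int" where
  "gamma_num P = (THE c. (\<forall>i > poly_dim P div 2. c i = 0) \<and>
     H_poly P = (\<Sum>i\<le>poly_dim P div 2.
       of_int (c i) * (alpha_var * t_var) ^ i * (alpha_var + t_var) ^ (poly_dim P - 2 * i)))"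

end

theory Submission
  imports Defs
begin

text \<open>
  Write $P_\Gamma$ for the graph-associahedron of a graph $\Gamma$ on $n+1$ vertices. Every inequality
  follows from one statement about $H(P_\Gamma)$: the differences $H(P_\Gamma) - H(As^n)$ and
  $H(Pe^n) - H(P_\Gamma)$, and $H(As^n)$ itself, are combinations of the polynomials
  $(\alpha t)^i (\alpha + t)^{n-2i}$ with nonnegative coefficients; such combinations form
  \<open>gamma_cone n\<close>. The numbers $g_i$, $h_i$ and $f_i$ are nonnegative combinations of
  the $\gamma_i$, because binomial coefficients are unimodal and $F(\alpha,t) = H(\alpha + t, t)$
  (\<open>gamma_cone_comparison\<close>). Membership in \<open>gamma_cone n\<close> also supplies the symmetry of $H$.

  Geometry enters only through the face numbers. The face of $P_\Gamma$ on which a functional $c$ is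
  maximal is the sum of the faces of the simplices $\Delta^S$ on which $c$ is maximal. It is
  determined by the sets of maximal points of $c$ on the connected sets $S$, hence by the nested set of
  all tubes of $c$, where the tube of $v$ is the connected component of $v$ in
  $\{u : c(u) \le c(v)\}$. Its dimension is the number of vertices minus the number of tubes
  (\<open>face_towards_eq_iff\<close>, \<open>aff_dim_face_towards\<close>). So $H(P_\Gamma)$ is the generating
  polynomial \<open>hpoly\<close> of nested sets.

  Removing the vertices whose tube is the whole graph gives a recursion for the generating polynomial,
  and from the recursion follows the effect of a new edge $uv$ on a connected graph $\Gamma$:
  $H(\Gamma + uv) = H(\Gamma) + \alpha t \sum H(\Gamma|_{S_1})\, H(\Gamma|_{S_2})\, H((\Gamma + uv)/(S_1 \cup S_2))$,
  where $S_1 \ni u$ and $S_2 \ni v$ run over the disjoint connected sets of $\Gamma$ without an edge of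
  $\Gamma$ between them, and $\Gamma/S$ arises from $\Gamma$ by deleting $S$ and joining all pairs of
  neighbours of $S$ (\<open>nest_poly_add_edge\<close>, \<open>hpoly_add_edge\<close>). Geometrically,
  $P_{\Gamma + uv}$ is obtained from $P_\Gamma$ by truncating the faces that correspond to the pairs
  $S_1, S_2$. If the new edge attaches a leaf $v$ to $u$, the same computation gives
  $H = (\alpha + t) H(\Gamma - v) + \alpha t \sum_S H(\Gamma|_S)\, H(\Gamma/(S \cup v))$ over the connected
  proper subsets $S \ni u$ of $\Gamma - v$ (\<open>hpoly_add_leaf\<close>).

  By induction on the number of vertices all these polynomials lie in the respective cones, so adding
  edges increases $H$ in the order given by the cone, which is the upper bound (\<open>hpoly_mono\<close>).
  For the lower bound (\<open>hpoly_ge_path\<close>), choose a vertex $v$ whose removal leaves a connected graph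
  and delete all edges at $v$ but one; this decreases $H$. The leaf formula then has at least one
  summand $S$ of each size $1, \dots, n-1$, and for the path with $v$ at its end exactly one
  (\<open>hpoly_path\<close>). The summands are compared by induction.
\<close>

section \<open>Connected vertex sets\<close>

text \<open>
  Connectedness is phrased through cuts instead of walks: an edge leaves every proper nonempty part. In
  this form restrictions, unions and contractions need only one edge across a cut at a time.
\<close>

definition conn :: "'v rel \<Rightarrow> 'v set \<Rightarrow> bool" where
  "conn E W \<longleftrightarrow> W \<noteq> {} \<and> (\<forall>A \<subseteq> W. A \<noteq> {} \<longrightarrow> A \<noteq> W \<longrightarrow> (\<exists>a\<in>A. \<exists>b\<in>W - A. (a, b) \<in> E))"

definition separated :: "'v rel \<Rightarrow> 'v set \<Rightarrow> 'v set \<Rightarrow> bool" where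
  "separated E A B \<longleftrightarrow> A \<inter> B = {} \<and> (\<forall>a\<in>A. \<forall>b\<in>B. (a, b) \<notin> E \<and> (b, a) \<notin> E)"

lemma connE:
  assumes "conn E W" "A \<subseteq> W" "A \<noteq> {}" "A \<noteq> W"
  obtains a b where "a \<in> A" "b \<in> W - A" "(a, b) \<in> E"
  using assms unfolding conn_def by blast

lemma conn_nonempty: "conn E W \<Longrightarrow> W \<noteq> {}"
  by (simp add: conn_def)

lemma conn_singleton: "conn E {v}"
  by (auto simp: conn_def)

text \<open>
  A cut of the union separates the common vertex from some other vertex, so it also cuts a member that
  contains this other vertex.
\<close>

lemma conn_Union:
  assumes "\<And>C. C \<in> \<C> \<Longrightarrow> conn E C \<and> v \<in> C" and "\<C> \<noteq> {}"
  shows "conn E (\<Union>\<C>)"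
  unfolding conn_def
proof (intro conjI allI impI)
  show "\<Union>\<C> \<noteq> {}"
    using assms by fastforce
  fix A assume A: "A \<subseteq> \<Union>\<C>" "A \<noteq> {}" "A \<noteq> \<Union>\<C>"
  have "\<exists>C\<in>\<C>. A \<inter> C \<noteq> {} \<and> A \<inter> C \<noteq> C"
  proof (cases "v \<in> A")
    case True
    obtain y C where "y \<in> C" "C \<in> \<C>" "y \<notin> A"
      using A by blast
    then show ?thesis
      using True assms(1) by blast
  next
    case False
    obtain x C where "x \<in> A" "x \<in> C" "C \<in> \<C>"
      using A by blast
    then show ?thesis
      using False assms(1) by blast
  qed
  then obtain C where C: "C \<in> \<C>" "A \<inter> C \<noteq> {}" "A \<inter> C \<noteq> C"
    by blast
  then obtain a b where "a \<in> A \<inter> C" "b \<in> C - A \<inter> C" "(a, b) \<in> E"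
    using assms(1) by (metis connE inf_le2)
  then show "\<exists>a\<in>A. \<exists>b\<in>\<Union>\<C> - A. (a, b) \<in> E"
    using C(1) by blast
qed

lemma conn_insert:
  assumes "conn E U" "u \<in> U" "(u, v) \<in> E" "sym E"
  shows "conn E (insert v U)"
proof -
  have "conn E {u, v}"
    unfolding conn_def
  proof (intro conjI allI impI)
    fix A assume "A \<subseteq> {u, v}" "A \<noteq> {}" "A \<noteq> {u, v}"
    then have "A = {u} \<and> u \<noteq> v \<or> A = {v} \<and> u \<noteq> v" by auto
    then show "\<exists>a\<in>A. \<exists>b\<in>{u, v} - A. (a, b) \<in> E"
      using assms(3,4) by (auto dest: symD)
  qed simp
  then have "conn E (\<Union>{U, {u, v}})"
    using assms by (intro conn_Union[where v = u]) auto
  moreover have "\<Union>{U, {u, v}} = insert v U"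
    using assms(2) by auto
  ultimately show ?thesis by simp
qed

lemma conn_mono: "conn E W \<Longrightarrow> E \<subseteq> E' \<Longrightarrow> conn E' W"
  unfolding conn_def by (meson subset_eq)

lemma conn_cong:
  assumes "E \<inter> W \<times> W = E' \<inter> W \<times> W"
  shows "conn E W \<longleftrightarrow> conn E' W"
proof -
  have "conn D W" if eq: "D' \<inter> W \<times> W = D \<inter> W \<times> W" and D': "conn D' W" for D D' :: "('a \<times> 'a) set"
    unfolding conn_def
  proof (intro conjI allI impI)
    show "W \<noteq> {}" using D' by (rule conn_nonempty)
    fix A assume A: "A \<subseteq> W" "A \<noteq> {}" "A \<noteq> W"
    obtain a b where "a \<in> A" "b \<in> W - A" "(a, b) \<in> D'"
      using D' A by (rule connE)
    then show "\<exists>a\<in>A. \<exists>b\<in>W - A. (a, b) \<in> D"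
      using A eq by blast
  qed
  then show ?thesis
    using assms by metis
qed

lemma separated_sym: "separated E A B \<Longrightarrow> separated E B A"
  by (auto simp: separated_def)

lemma separated_subset: "separated E A B \<Longrightarrow> A' \<subseteq> A \<Longrightarrow> B' \<subseteq> B \<Longrightarrow> separated E A' B'"
  unfolding separated_def by blast

lemma conn_separated_cases:
  assumes "conn E C" "C \<subseteq> A \<union> B" "separated E A B"
  shows "C \<subseteq> A \<or> C \<subseteq> B"
proof (rule ccontr)
  assume not: "\<not> (C \<subseteq> A \<or> C \<subseteq> B)"
  have "C \<inter> A \<subseteq> C" "C \<inter> A \<noteq> {}" "C \<inter> A \<noteq> C"
    using not assms(2) by auto
  then obtain a b where "a \<in> C \<inter> A" "b \<in> C - C \<inter> A" "(a, b) \<in> E"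
    by (meson assms(1) connE)
  then show False
    using assms by (auto simp: separated_def)
qed

lemma conn_separated_mem:
  assumes "conn E C" "C \<subseteq> A \<union> B" "separated E A B" "v \<in> C" "v \<in> A"
  shows "C \<subseteq> A"
  using conn_separated_cases[OF assms(1-3)] assms by (auto simp: separated_def)

lemma not_connE:
  assumes "\<not> conn E W" "u \<in> W" "sym E"
  obtains A B where "W = A \<union> B" "u \<in> A" "B \<noteq> {}" "separated E A B"
proof -
  obtain A where A: "A \<subseteq> W" "A \<noteq> {}" "A \<noteq> W" "\<And>a b. a \<in> A \<Longrightarrow> b \<in> W - A \<Longrightarrow> (a, b) \<notin> E"
    using assms unfolding conn_def by blast
  then have "separated E A (W - A)"
    using assms(3) by (auto simp: separated_def dest: symD)
  then show thesis
    using A that[of A "W - A"] that[of "W - A" A] assms(2) separated_sym by fastforce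
qed

section \<open>Tubes and nested sets\<close>

definition level :: "('v \<Rightarrow> real) \<Rightarrow> 'v set \<Rightarrow> 'v \<Rightarrow> 'v set" where
  "level c U v = {u \<in> U. c u \<le> c v}"

text \<open>
  This is the connected component of $v$ in its sublevel set. Tubes record where $c$ attains maxima: for a
  connected set $S \subseteq U$, the function $c$ is maximal on $S$ at $v \in S$ exactly when $S$ is
  contained in the tube of $v$.
\<close>

definition tube :: "'v rel \<Rightarrow> ('v \<Rightarrow> real) \<Rightarrow> 'v set \<Rightarrow> 'v \<Rightarrow> 'v set" where
  "tube E c U v = \<Union>{C. conn E C \<and> v \<in> C \<and> C \<subseteq> level c U v}"

definition nest :: "'v rel \<Rightarrow> 'v set \<Rightarrow> ('v \<Rightarrow> real) \<Rightarrow> 'v set set" where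
  "nest E U c = tube E c U ` U"

text \<open>
  These families are the nested sets of the graph induced on $U$ that contain all of its connected
  components. Generating them from real functions makes each of them visible as the label of the face
  on which a functional is maximal.
\<close>

definition nests :: "'v rel \<Rightarrow> 'v set \<Rightarrow> 'v set set set" where
  "nests E U = range (nest E U)"

lemma tube_subset_level: "tube E c U v \<subseteq> level c U v"
  by (auto simp: tube_def)

lemma tube_subset: "tube E c U v \<subseteq> U"
  by (auto simp: tube_def level_def)

lemma tube_maximal: "conn E C \<Longrightarrow> v \<in> C \<Longrightarrow> C \<subseteq> level c U v \<Longrightarrow> C \<subseteq> tube E c U v"
  by (auto simp: tube_def)

lemma mem_tube: "v \<in> U \<Longrightarrow> v \<in> tube E c U v"
  using tube_maximal[OF conn_singleton, of v v c U E] by (auto simp: level_def)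

lemma conn_tube:
  assumes "v \<in> U"
  shows "conn E (tube E c U v)"
  unfolding tube_def
proof (rule conn_Union)
  have "{v} \<in> {C. conn E C \<and> v \<in> C \<and> C \<subseteq> level c U v}"
    using assms by (auto simp: level_def conn_singleton)
  then show "{C. conn E C \<and> v \<in> C \<and> C \<subseteq> level c U v} \<noteq> {}" by blast
  show "conn E C \<and> v \<in> C" if "C \<in> {C. conn E C \<and> v \<in> C \<and> C \<subseteq> level c U v}" for C
    using that by simp
qed

lemma nest_subset: "N \<in> nests E U \<Longrightarrow> X \<in> N \<Longrightarrow> X \<subseteq> U \<and> X \<noteq> {}"
  using tube_subset mem_tube by (fastforce simp: nests_def nest_def)

lemma Union_nest: "N \<in> nests E U \<Longrightarrow> \<Union>N = U"
  using tube_subset mem_tube by (fastforce simp: nests_def nest_def)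

lemma tube_cong:
  assumes "E \<inter> U \<times> U = E' \<inter> U \<times> U" "\<And>u. u \<in> U \<Longrightarrow> c u = c' u" "v \<in> U"
  shows "tube E c U v = tube E' c' U v"
proof -
  have "level c U v = level c' U v"
    using assms by (auto simp: level_def)
  moreover have "conn E C \<longleftrightarrow> conn E' C" if "C \<subseteq> level c U v" for C
  proof -
    have "C \<subseteq> U"
      using that by (auto simp: level_def)
    then have "E \<inter> C \<times> C = E' \<inter> C \<times> C"
      using assms(1) by blast
    then show ?thesis by (rule conn_cong)
  qed
  ultimately show ?thesis
    by (auto simp: tube_def)
qed

lemma nest_cong:
  assumes "E \<inter> U \<times> U = E' \<inter> U \<times> U" "\<And>u. u \<in> U \<Longrightarrow> c u = c' u"
  shows "nest E U c = nest E' U c'"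
  using tube_cong[OF assms] by (auto simp: nest_def)

lemma nests_cong:
  assumes "E \<inter> U \<times> U = E' \<inter> U \<times> U"
  shows "nests E U = nests E' U"
proof -
  have "nest E U = nest E' U"
    by (intro ext nest_cong[OF assms] refl)
  then show ?thesis by (simp add: nests_def)
qed

text \<open>
  Connected sets cannot cross a separation, so tubes do not see the part of the vertex set that lies on
  the other side.
\<close>

lemma tube_restrict:
  assumes "v \<in> A" "separated E A B"
  shows "tube E c (A \<union> B) v = tube E c A v"
proof -
  have "C \<subseteq> level c A v" if "conn E C" "v \<in> C" "C \<subseteq> level c (A \<union> B) v" for C
  proof -
    have "C \<subseteq> A \<union> B"
      using that(3) by (auto simp: level_def)
    then have "C \<subseteq> A"
      using conn_separated_mem that assms by metis
    then show ?thesis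
      using that(3) by (auto simp: level_def)
  qed
  moreover have "level c A v \<subseteq> level c (A \<union> B) v"
    by (auto simp: level_def)
  ultimately show ?thesis
    unfolding tube_def by (intro arg_cong[where f = Union] Collect_cong) blast
qed

lemma nest_separated:
  assumes "separated E A B"
  shows "nest E (A \<union> B) c = nest E A c \<union> nest E B c"
proof -
  have "tube E c (A \<union> B) v = tube E c A v" if "v \<in> A" for v
    using tube_restrict[OF that assms] .
  moreover have "tube E c (A \<union> B) v = tube E c B v" if "v \<in> B" for v
    using tube_restrict[OF that separated_sym[OF assms]] by (simp add: Un_commute)
  ultimately show ?thesis
    by (simp add: nest_def image_Un)
qed

text \<open>
  On a separated union, functions on the two parts can be chosen independently.
\<close>

lemma nests_separated:
  assumes "separated E A B"
  shows "nests E (A \<union> B) = (\<lambda>(N, N'). N \<union> N') ` (nests E A \<times> nests E B)"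
proof -
  have "nest E A c \<union> nest E B d \<in> nests E (A \<union> B)" for c d
  proof -
    define e where "e v = (if v \<in> A then c v else d v)" for v
    have "nest E A c = nest E A e" "nest E B d = nest E B e"
      using assms by (auto intro!: nest_cong simp: e_def separated_def)
    then show ?thesis
      using nest_separated[OF assms, of e] unfolding nests_def by (metis rangeI)
  qed
  moreover have "nest E (A \<union> B) c \<in> (\<lambda>(N, N'). N \<union> N') ` (nests E A \<times> nests E B)" for c
    using nest_separated[OF assms, of c] by (auto simp: nests_def)
  ultimately show ?thesis
    by (auto simp: nests_def)
qed

lemma inj_on_nests_separated:
  assumes "separated E A B"
  shows "inj_on (\<lambda>(N, N'). N \<union> N') (nests E A \<times> nests E B)"
proof (rule inj_onI, clarify)
  fix N M N' M'
  assume N: "N \<in> nests E A" "M \<in> nests E A" "N' \<in> nests E B" "M' \<in> nests E B"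
    and eq: "N \<union> N' = M \<union> M'"
  have *: "P = {X \<in> P \<union> P'. X \<subseteq> A}" "P' = {X \<in> P \<union> P'. X \<subseteq> B}"
    if "P \<in> nests E A" "P' \<in> nests E B" for P P'
    using nest_subset[OF that(1)] nest_subset[OF that(2)] assms
    unfolding separated_def by blast+
  show "N = M \<and> N' = M'"
    using *[OF N(1,3)] *[OF N(2,4)] eq by metis
qed

text \<open>
  On a connected set $W$, the vertices where $c$ is maximal on $W$ all have the tube $W$; they form the
  set $M$. No sublevel set of another vertex meets $M$. Conversely, a function on $W - M$ extends
  to $W$ by a larger constant on $M$.
\<close>

lemma nests_conn:
  fixes W :: "'v::finite set"
  assumes "conn E W"
  shows "nests E W = (\<Union>M\<in>{M. M \<subseteq> W \<and> M \<noteq> {}}. insert W ` nests E (W - M))"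
proof (intro equalityI subsetI)
  fix N assume "N \<in> nests E W"
  then obtain c where N: "N = nest E W c" by (auto simp: nests_def)
  have W: "W \<noteq> {}" "finite W"
    using assms conn_nonempty by auto
  define m where "m = Max (c ` W)"
  define M where "M = {v \<in> W. c v = m}"
  have le: "c v \<le> m" if "v \<in> W" for v
    using that W by (simp add: m_def)
  have "m \<in> c ` W"
    unfolding m_def using W by (intro Max_in) auto
  then have M: "M \<subseteq> W" "M \<noteq> {}"
    by (auto simp: M_def)
  have "tube E c W v = W" if "v \<in> M" for v
  proof -
    have "W \<subseteq> level c W v"
      using that le by (auto simp: level_def M_def)
    then have "W \<subseteq> tube E c W v"
      using tube_maximal[OF assms, of v] that M by blast
    then show ?thesis
      by (intro equalityI tube_subset)
  qed
  moreover have "tube E c W v = tube E c (W - M) v" if "v \<in> W - M" for v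
  proof -
    have "c v < m"
      using that le[of v] by (auto simp: M_def)
    then have "level c W v = level c (W - M) v"
      by (auto simp: level_def M_def)
    then show ?thesis by (simp add: tube_def)
  qed
  moreover have "tube E c W ` W = tube E c W ` M \<union> tube E c W ` (W - M)"
    using M(1) by blast
  ultimately have "N = insert W (nest E (W - M) c)"
    using M(2) by (auto simp: N nest_def)
  then have "N \<in> insert W ` nests E (W - M)"
    by (simp add: nests_def)
  then show "N \<in> (\<Union>M\<in>{M. M \<subseteq> W \<and> M \<noteq> {}}. insert W ` nests E (W - M))"
    using M by blast
next
  fix N assume "N \<in> (\<Union>M\<in>{M. M \<subseteq> W \<and> M \<noteq> {}}. insert W ` nests E (W - M))"
  then obtain M where M: "M \<subseteq> W" "M \<noteq> {}" and "N \<in> insert W ` nests E (W - M)"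
    by blast
  then obtain c where N: "N = insert W (nest E (W - M) c)"
    unfolding nests_def by blast
  define m where "m = Max (c ` W)"
  define d where "d v = (if v \<in> M then m + 1 else c v)" for v
  have d: "d v < d u" if "v \<in> W - M" "u \<in> M" for u v
  proof -
    have "c v \<le> m"
      using that unfolding m_def by (intro Max_ge) auto
    then show ?thesis
      using that by (simp add: d_def)
  qed
  have "tube E d W v = W" if "v \<in> M" for v
  proof -
    have "d u \<le> d v" if "u \<in> W" for u
      using that \<open>v \<in> M\<close> d[of u v] by (cases "u \<in> M") (auto simp: d_def)
    then have "W \<subseteq> level d W v"
      by (auto simp: level_def)
    then have "W \<subseteq> tube E d W v"
      using tube_maximal[OF assms, of v] that M by blast
    then show ?thesis
      by (intro equalityI tube_subset)
  qed
  moreover have "tube E d W v = tube E c (W - M) v" if "v \<in> W - M" for v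
  proof -
    have "level d W v = level d (W - M) v"
      using d[OF that] by (auto simp: level_def not_le[symmetric])
    also have "\<dots> = level c (W - M) v"
      using that by (auto simp: level_def d_def)
    finally show ?thesis by (simp add: tube_def)
  qed
  moreover have "tube E d W ` W = tube E d W ` M \<union> tube E d W ` (W - M)"
    using M(1) by blast
  ultimately have "N = nest E W d"
    using M(2) by (auto simp: N nest_def)
  then show "N \<in> nests E W"
    by (auto simp: nests_def)
qed

section \<open>Counting nested sets\<close>

text \<open>
  A nested set with $k$ tubes labels a face of dimension $|W| - k$, so for connected $W$ this is
  $t\,F(x,t)$. The extra factor $t$ makes the polynomial multiplicative over connected components, and
  leaving $x$ arbitrary covers both $F$ ($x = \alpha$) and $H$ ($x = \alpha - t$).
\<close>

definition nest_poly :: "'r::idom \<Rightarrow> 'r \<Rightarrow> 'v::finite rel \<Rightarrow> 'v set \<Rightarrow> 'r" where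
  "nest_poly x t E W = (\<Sum>N\<in>nests E W. x ^ (card W - card N) * t ^ card N)"

lemma card_nest_le:
  fixes U :: "'v::finite set"
  assumes "N \<in> nests E U"
  shows "card N \<le> card U"
proof -
  obtain c where "N = nest E U c"
    using assms unfolding nests_def by blast
  then show ?thesis
    by (simp add: nest_def card_image_le)
qed

lemma nest_poly_cong:
  assumes "E \<inter> W \<times> W = E' \<inter> W \<times> W"
  shows "nest_poly x t E W = nest_poly x t E' W"
  unfolding nest_poly_def nests_cong[OF assms] ..

lemma nest_poly_empty [simp]: "nest_poly x t E {} = 1"
proof -
  have "nests E {} = {{}}"
    by (auto simp: nests_def nest_def)
  then show ?thesis by (simp add: nest_poly_def)
qed

lemma nest_poly_separated:
  assumes "separated E A B"
  shows "nest_poly x t E (A \<union> B) = nest_poly x t E A * nest_poly x t E B"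
proof -
  have "nest_poly x t E (A \<union> B) =
      (\<Sum>(N, N')\<in>nests E A \<times> nests E B. x ^ (card (A \<union> B) - card (N \<union> N')) * t ^ card (N \<union> N'))"
    unfolding nest_poly_def nests_separated[OF assms]
    by (subst sum.reindex[OF inj_on_nests_separated[OF assms]]) (simp add: case_prod_unfold)
  also have "\<dots> = (\<Sum>(N, N')\<in>nests E A \<times> nests E B.
      (x ^ (card A - card N) * t ^ card N) * (x ^ (card B - card N') * t ^ card N'))"
  proof (rule sum.cong[OF refl], clarify)
    fix N N' assume N: "N \<in> nests E A" "N' \<in> nests E B"
    have "N \<inter> N' = {}"
      using nest_subset[OF N(1)] nest_subset[OF N(2)] assms unfolding separated_def by blast
    then have 1: "card (N \<union> N') = card N + card N'"
      by (simp add: card_Un_disjoint)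
    have 2: "card (A \<union> B) = card A + card B"
      using assms by (simp add: card_Un_disjoint separated_def)
    have "card A + card B - (card N + card N') = (card A - card N) + (card B - card N')"
      using card_nest_le[OF N(1)] card_nest_le[OF N(2)] by simp
    then show "x ^ (card (A \<union> B) - card (N \<union> N')) * t ^ card (N \<union> N') =
        x ^ (card A - card N) * t ^ card N * (x ^ (card B - card N') * t ^ card N')"
      by (simp add: 1 2 power_add algebra_simps)
  qed
  also have "\<dots> = nest_poly x t E A * nest_poly x t E B"
    by (simp add: nest_poly_def sum_product sum.cartesian_product)
  finally show ?thesis .
qed

text \<open>
  The recursion peels off the set $M$ of vertices with tube $W$. It contributes the single tube $W$,
  which accounts for the factor $t\,x^{|M|-1}$; $M$ can be recovered from the nested set because the
  remaining tubes cover exactly $W - M$.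
\<close>

lemma nest_poly_conn:
  assumes "conn E W"
  shows "nest_poly x t E W =
    t * (\<Sum>M | M \<subseteq> W \<and> M \<noteq> {}. x ^ (card M - 1) * nest_poly x t E (W - M))"
proof -
  have notin: "W \<notin> N" if "N \<in> nests E (W - M)" "M \<subseteq> W" "M \<noteq> {}" for M N
    using nest_subset[OF that(1)] that(2,3) by blast
  have inj: "N = N'" if "insert W N = insert W N'" "N \<in> nests E (W - M)" "N' \<in> nests E (W - M')"
    "M \<subseteq> W" "M \<noteq> {}" "M' \<subseteq> W" "M' \<noteq> {}" for M M' N N'
    using that(1) notin[OF that(2,4,5)] notin[OF that(3,6,7)] by (simp add: insert_ident)
  have "nest_poly x t E W = (\<Sum>M | M \<subseteq> W \<and> M \<noteq> {}.
      \<Sum>N\<in>insert W ` nests E (W - M). x ^ (card W - card N) * t ^ card N)"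
    unfolding nest_poly_def nests_conn[OF assms]
  proof (rule sum.UNION_disjoint)
    show "\<forall>M\<in>{M. M \<subseteq> W \<and> M \<noteq> {}}. \<forall>M'\<in>{M. M \<subseteq> W \<and> M \<noteq> {}}. M \<noteq> M' \<longrightarrow>
        insert W ` nests E (W - M) \<inter> insert W ` nests E (W - M') = {}"
    proof (intro ballI impI, rule ccontr)
      fix M M' assume M: "M \<in> {M. M \<subseteq> W \<and> M \<noteq> {}}" "M' \<in> {M. M \<subseteq> W \<and> M \<noteq> {}}" "M \<noteq> M'"
        and "insert W ` nests E (W - M) \<inter> insert W ` nests E (W - M') \<noteq> {}"
      then obtain K where "K \<in> insert W ` nests E (W - M)" "K \<in> insert W ` nests E (W - M')"
        by (auto simp only: disjoint_iff)
      then obtain N N' where N: "N \<in> nests E (W - M)" "N' \<in> nests E (W - M')"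
          "insert W N = insert W N'"
        by (metis (no_types) imageE)
      then have "N = N'"
        using inj[OF N(3,1,2)] M by simp
      then have "W - M = W - M'"
        using Union_nest[OF N(1)] Union_nest[OF N(2)] by simp
      then show False
        using M by blast
    qed
  qed simp_all
  also have "\<dots> = (\<Sum>M | M \<subseteq> W \<and> M \<noteq> {}. \<Sum>N\<in>nests E (W - M).
      x ^ (card W - card (insert W N)) * t ^ card (insert W N))"
  proof (rule sum.cong[OF refl], rule sum.reindex_cong[of "insert W"])
    fix M assume M: "M \<in> {M. M \<subseteq> W \<and> M \<noteq> {}}"
    show "inj_on (insert W) (nests E (W - M))"
      using inj M by (intro inj_onI) simp
  qed simp_all
  also have "\<dots> = (\<Sum>M | M \<subseteq> W \<and> M \<noteq> {}. \<Sum>N\<in>nests E (W - M).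
      t * (x ^ (card M - 1) * (x ^ (card (W - M) - card N) * t ^ card N)))"
  proof (intro sum.cong[OF refl])
    fix M N assume M: "M \<in> {M. M \<subseteq> W \<and> M \<noteq> {}}" and N: "N \<in> nests E (W - M)"
    have 1: "card (insert W N) = Suc (card N)"
      using notin[OF N] M by simp
    have "card M > 0" "card (W - M) = card W - card M" "card M \<le> card W"
      using M by (auto simp: card_gt_0_iff card_Diff_subset card_mono)
    then have "card W - Suc (card N) = (card M - 1) + (card (W - M) - card N)"
      using card_nest_le[OF N] by linarith
    then show "x ^ (card W - card (insert W N)) * t ^ card (insert W N) =
        t * (x ^ (card M - 1) * (x ^ (card (W - M) - card N) * t ^ card N))"
      unfolding 1 by (simp add: power_add algebra_simps)
  qed
  also have "\<dots> = t * (\<Sum>M | M \<subseteq> W \<and> M \<noteq> {}. x ^ (card M - 1) * nest_poly x t E (W - M))"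
    by (simp add: nest_poly_def sum_distrib_left)
  finally show ?thesis .
qed

section \<open>Adding an edge\<close>

definition add_edge :: "'v rel \<Rightarrow> 'v \<Rightarrow> 'v \<Rightarrow> 'v rel" where
  "add_edge E u v = E \<union> {(u, v), (v, u)}"

text \<open>
  Restricted to the complement of $S$, this is the graph in which two vertices are adjacent when they
  are joined by an edge or by a path through $S$, provided that $S$ is connected. The vertices of $S$
  are kept in the relation; only its restriction to their complement is used.
\<close>

definition contract :: "'v rel \<Rightarrow> 'v set \<Rightarrow> 'v rel" where
  "contract E S = E \<union> {(a, b). a \<noteq> b \<and> (\<exists>s\<in>S. (a, s) \<in> E) \<and> (\<exists>s\<in>S. (b, s) \<in> E)}"

text \<open>
  If $u$ and $v$ become adjacent, $S_1 \cup S_2$ becomes connected, with the new edge as a bridge.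
\<close>

definition splits :: "'v rel \<Rightarrow> 'v \<Rightarrow> 'v \<Rightarrow> 'v set \<Rightarrow> ('v set \<times> 'v set) set" where
  "splits E u v W = {(S1, S2). conn E S1 \<and> conn E S2 \<and> separated E S1 S2 \<and>
     u \<in> S1 \<and> v \<in> S2 \<and> S1 \<union> S2 \<subseteq> W}"

lemma sym_add_edge: "sym E \<Longrightarrow> sym (add_edge E u v)"
  by (auto simp: add_edge_def sym_def)

lemma sym_contract: "sym E \<Longrightarrow> sym (contract E S)"
  unfolding contract_def sym_def by blast

text \<open>
  An edge leaves $A$ and an edge leaves the rest $B$ of $W - S$. If neither of them joins $A$ to $B$,
  both end in $S$, and contraction joins their other ends.
\<close>

lemma conn_contract:
  assumes "conn E W" "sym E" "S \<subseteq> W" "S \<noteq> W"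
  shows "conn (contract E S) (W - S)"
  unfolding conn_def
proof (intro conjI allI impI)
  show "W - S \<noteq> {}" using assms by blast
  fix A assume A: "A \<subseteq> W - S" "A \<noteq> {}" "A \<noteq> W - S"
  define B where "B = W - S - A"
  obtain a b where ab: "a \<in> A" "b \<in> W - A" "(a, b) \<in> E"
    using assms(1) by (rule connE[of _ _ A]) (use A in auto)
  obtain c d where cd: "c \<in> B" "d \<in> W - B" "(c, d) \<in> E"
    using assms(1) by (rule connE[of _ _ B]) (use A assms in \<open>auto simp: B_def\<close>)
  \<comment> \<open>In the third case the ends of both edges in the contracted set make a and c adjacent.\<close>
  consider "b \<in> B" | "d \<in> A" | "b \<in> S" "d \<in> S"
    using ab cd by (auto simp: B_def)
  then have "\<exists>a\<in>A. \<exists>b\<in>B. (a, b) \<in> contract E S"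
  proof cases
    case 1
    then show ?thesis using ab by (auto simp: contract_def)
  next
    case 2
    then show ?thesis using cd assms(2) by (auto simp: contract_def dest: symD)
  next
    case 3
    have "a \<noteq> c" using ab cd by (auto simp: B_def)
    then have "(a, c) \<in> contract E S"
      using 3 ab cd by (auto simp: contract_def)
    then show ?thesis using ab cd by blast
  qed
  then show "\<exists>a\<in>A. \<exists>b\<in>W - S - A. (a, b) \<in> contract E S"
    by (simp add: B_def)
qed

lemma splits_Diff:
  "splits E u v (W - M) = {p \<in> splits E u v W. (fst p \<union> snd p) \<inter> M = {}}"
  by (auto simp: splits_def)

text \<open>
  The recursion \<open>nest_poly_conn\<close> multiplied by $x$, which avoids the truncated exponent.
\<close>

lemma removal_sum_conn:
  assumes "conn E W"
  shows "x * nest_poly x t E W = t * (\<Sum>M | M \<subseteq> W \<and> M \<noteq> {}. x ^ card M * nest_poly x t E (W - M))"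
proof -
  have "x ^ card M = x * x ^ (card M - 1)" if "M \<noteq> {}" for M :: "'a set"
    using that by (cases "card M") auto
  then show ?thesis
    unfolding nest_poly_conn[OF assms]
    by (simp add: sum_distrib_left mult.assoc mult.left_commute[of x])
qed

lemma sum_all_subsets:
  fixes W :: "'v::finite set" and f :: "'v set \<Rightarrow> 'r::comm_monoid_add"
  shows "(\<Sum>M | M \<subseteq> W. f M) = f {} + (\<Sum>M | M \<subseteq> W \<and> M \<noteq> {}. f M)"
proof -
  have "{M. M \<subseteq> W} = insert {} {M. M \<subseteq> W \<and> M \<noteq> {}}" by auto
  then show ?thesis by simp
qed

lemma removal_sum_all_conn:
  assumes "conn E W"
  shows "t * (\<Sum>M | M \<subseteq> W. x ^ card M * nest_poly x t E (W - M)) = (x + t) * nest_poly x t E W"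
  unfolding sum_all_subsets using removal_sum_conn[OF assms, of x t] by (simp add: algebra_simps)

text \<open>
  Including $M = \emptyset$ makes the sum over removed sets multiplicative, which the
  sum over nonempty $M$ is not.
\<close>

lemma removal_sum_all_separated:
  assumes "separated E A B"
  shows "(\<Sum>M | M \<subseteq> A \<union> B. x ^ card M * nest_poly x t E (A \<union> B - M)) =
    (\<Sum>M | M \<subseteq> A. x ^ card M * nest_poly x t E (A - M)) *
    (\<Sum>M | M \<subseteq> B. x ^ card M * nest_poly x t E (B - M))"
proof -
  have disj: "A \<inter> B = {}"
    using assms by (simp add: separated_def)
  have "bij_betw (\<lambda>(M, N). M \<union> N) ({M. M \<subseteq> A} \<times> {N. N \<subseteq> B}) {M. M \<subseteq> A \<union> B}"
    by (rule bij_betw_byWitness[where f' = "\<lambda>M. (M \<inter> A, M \<inter> B)"]) (use disj in auto)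
  then have "(\<Sum>M | M \<subseteq> A \<union> B. x ^ card M * nest_poly x t E (A \<union> B - M)) =
    (\<Sum>(M, N)\<in>{M. M \<subseteq> A} \<times> {N. N \<subseteq> B}. x ^ card (M \<union> N) * nest_poly x t E (A \<union> B - (M \<union> N)))"
    by (subst sum.reindex_bij_betw[symmetric]) (auto simp: case_prod_unfold)
  also have "\<dots> = (\<Sum>(M, N)\<in>{M. M \<subseteq> A} \<times> {N. N \<subseteq> B}.
      (x ^ card M * nest_poly x t E (A - M)) * (x ^ card N * nest_poly x t E (B - N)))"
  proof (rule sum.cong[OF refl], clarify)
    fix M N assume MN: "M \<subseteq> A" "N \<subseteq> B"
    have 1: "card (M \<union> N) = card M + card N"
      using MN disj by (intro card_Un_disjoint) auto
    have 2: "A \<union> B - (M \<union> N) = (A - M) \<union> (B - N)"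
      using MN disj by auto
    have 3: "separated E (A - M) (B - N)"
      using assms by (rule separated_subset) auto
    show "x ^ card (M \<union> N) * nest_poly x t E (A \<union> B - (M \<union> N)) =
       x ^ card M * nest_poly x t E (A - M) * (x ^ card N * nest_poly x t E (B - N))"
      unfolding 1 2 nest_poly_separated[OF 3] by (simp add: power_add algebra_simps)
  qed
  finally show ?thesis
    by (simp add: sum_product sum.cartesian_product)
qed

definition split_sum :: "'r::idom \<Rightarrow> 'r \<Rightarrow> 'v::finite rel \<Rightarrow> 'v \<Rightarrow> 'v \<Rightarrow> 'v set \<Rightarrow> 'r" where
  "split_sum x t E u v W = (\<Sum>(S1, S2)\<in>splits E u v W. nest_poly x t E S1 * nest_poly x t E S2 *
     nest_poly x t (contract (add_edge E u v) (S1 \<union> S2)) (W - (S1 \<union> S2)))"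

lemma separated_contract:
  assumes "separated E A B" "S \<subseteq> A"
  shows "separated (contract E S) (A - S) B" "contract E S \<inter> B \<times> B = E \<inter> B \<times> B"
  using assms unfolding separated_def contract_def by blast+

lemma nest_poly_add_edge_outside:
  assumes "u \<notin> W \<or> v \<notin> W"
  shows "nest_poly x t (add_edge E u v) W = nest_poly x t E W"
  by (rule nest_poly_cong) (use assms in \<open>auto simp: add_edge_def\<close>)

lemma split_sum_outside:
  assumes "u \<notin> W \<or> v \<notin> W"
  shows "split_sum x t E u v W = 0"
proof -
  have "splits E u v W = {}"
    using assms by (auto simp: splits_def)
  then show ?thesis
    by (simp add: split_sum_def)
qed

lemma separated_add_edge: "separated (add_edge E u v) A B \<Longrightarrow> separated E A B"
  by (auto simp: separated_def add_edge_def)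

lemma split_sum_separated:
  assumes "separated (add_edge E u v) A B" "u \<in> A" "v \<in> A"
  shows "split_sum x t E u v (A \<union> B) = split_sum x t E u v A * nest_poly x t E B"
proof -
  note sepE = separated_add_edge[OF assms(1)]
  have nB: "u \<notin> B" using assms by (auto simp: separated_def)
  have "splits E u v (A \<union> B) = splits E u v A"
  proof (intro equalityI subsetI)
    fix p assume "p \<in> splits E u v (A \<union> B)"
    then obtain S1 S2 where p: "p = (S1, S2)" "conn E S1" "conn E S2" "separated E S1 S2"
      "u \<in> S1" "v \<in> S2" "S1 \<subseteq> A \<union> B" "S2 \<subseteq> A \<union> B"
      by (auto simp: splits_def)
    have "S1 \<subseteq> A" "S2 \<subseteq> A"
      using conn_separated_mem[OF p(2,7) sepE p(5) assms(2)]
        conn_separated_mem[OF p(3,8) sepE p(6) assms(3)] .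
    then show "p \<in> splits E u v A"
      using p by (auto simp: splits_def)
  qed (auto simp: splits_def)
  moreover have "nest_poly x t (contract (add_edge E u v) S) (A \<union> B - S) =
      nest_poly x t (contract (add_edge E u v) S) (A - S) * nest_poly x t E B" if "S \<subseteq> A" for S
  proof -
    note sc = separated_contract[OF assms(1) that]
    have "A \<union> B - S = (A - S) \<union> B"
      using that assms(1) by (auto simp: separated_def)
    moreover have "nest_poly x t (contract (add_edge E u v) S) B = nest_poly x t (add_edge E u v) B"
      using sc(2) by (rule nest_poly_cong)
    ultimately show ?thesis
      using nest_poly_separated[OF sc(1), of x t] nest_poly_add_edge_outside[of u B v x t E] nB by simp
  qed
  ultimately show ?thesis
    unfolding split_sum_def sum_distrib_right
    by (intro sum.cong) (auto simp: splits_def algebra_simps)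
qed

text \<open>
  Interchanging the two summations leaves, for each split with union $S$, the recursion for the graph
  contracted along $S$. This graph is connected on $W - S$, and the recursion is empty exactly if
  $S = W$, which is why those splits are missing on the right.
\<close>

lemma removal_sum_split_sum:
  assumes "conn (add_edge E u v) W" "sym E"
  shows "t * (\<Sum>M | M \<subseteq> W \<and> M \<noteq> {}. x ^ card M * split_sum x t E u v (W - M)) =
    x * (\<Sum>(S1, S2) | (S1, S2) \<in> splits E u v W \<and> S1 \<union> S2 \<noteq> W.
      nest_poly x t E S1 * nest_poly x t E S2 *
      nest_poly x t (contract (add_edge E u v) (S1 \<union> S2)) (W - (S1 \<union> S2)))"
proof -
  define g where "g p U = nest_poly x t E (fst p) * nest_poly x t E (snd p) *
     nest_poly x t (contract (add_edge E u v) (fst p \<union> snd p)) (U - (fst p \<union> snd p))" for p U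
  have "(\<Sum>M | M \<subseteq> W \<and> M \<noteq> {}. x ^ card M * split_sum x t E u v (W - M)) =
    (\<Sum>M | M \<subseteq> W \<and> M \<noteq> {}. \<Sum>p | p \<in> splits E u v W \<and> (fst p \<union> snd p) \<inter> M = {}.
       x ^ card M * g p (W - M))"
    by (simp add: split_sum_def g_def splits_Diff sum_distrib_left case_prod_unfold)
  also have "\<dots> = (\<Sum>p\<in>splits E u v W. \<Sum>M | M \<in> {M. M \<subseteq> W \<and> M \<noteq> {}} \<and> (fst p \<union> snd p) \<inter> M = {}.
       x ^ card M * g p (W - M))"
    by (rule sum.swap_restrict) simp_all
  finally have "t * (\<Sum>M | M \<subseteq> W \<and> M \<noteq> {}. x ^ card M * split_sum x t E u v (W - M)) =
    (\<Sum>p\<in>splits E u v W. t * (\<Sum>M | M \<in> {M. M \<subseteq> W \<and> M \<noteq> {}} \<and> (fst p \<union> snd p) \<inter> M = {}.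
       x ^ card M * g p (W - M)))"
    by (simp add: sum_distrib_left)
  also have "\<dots> = (\<Sum>p\<in>splits E u v W. if fst p \<union> snd p \<noteq> W then x * g p W else 0)"
  proof (rule sum.cong[OF refl])
    fix p assume p: "p \<in> splits E u v W"
    define S where "S = fst p \<union> snd p"
    have S: "S \<subseteq> W" using p by (auto simp: splits_def S_def)
    have Ms: "{M. M \<in> {M. M \<subseteq> W \<and> M \<noteq> {}} \<and> S \<inter> M = {}} = {M. M \<subseteq> W - S \<and> M \<noteq> {}}"
      by auto
    have "t * (\<Sum>M | M \<subseteq> W - S \<and> M \<noteq> {}. x ^ card M * g p (W - M)) = (if S \<noteq> W then x * g p W else 0)"
    proof (cases "S = W")
      case True
      then have "{M. M \<subseteq> W - S \<and> M \<noteq> {}} = {}" by auto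
      then have "(\<Sum>M | M \<subseteq> W - S \<and> M \<noteq> {}. x ^ card M * g p (W - M)) = 0"
        by (simp only: sum.empty)
      then show ?thesis using True by simp
    next
      case False
      have c: "conn (contract (add_edge E u v) S) (W - S)"
        using assms S False by (intro conn_contract sym_add_edge)
      have "W - M - S = W - S - M" for M by auto
      then have "t * (\<Sum>M | M \<subseteq> W - S \<and> M \<noteq> {}. x ^ card M * g p (W - M)) =
        nest_poly x t E (fst p) * nest_poly x t E (snd p) * (t * (\<Sum>M | M \<subseteq> W - S \<and> M \<noteq> {}.
          x ^ card M * nest_poly x t (contract (add_edge E u v) S) (W - S - M)))"
        by (simp add: g_def S_def[symmetric] sum_distrib_left algebra_simps)
      also have "\<dots> = x * g p W"
        unfolding removal_sum_conn[OF c, symmetric] by (simp add: g_def S_def)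
      finally show ?thesis using False by simp
    qed
    then show "t * (\<Sum>M | M \<in> {M. M \<subseteq> W \<and> M \<noteq> {}} \<and> (fst p \<union> snd p) \<inter> M = {}.
       x ^ card M * g p (W - M)) = (if fst p \<union> snd p \<noteq> W then x * g p W else 0)"
      unfolding S_def[symmetric] Ms .
  qed
  also have "\<dots> = x * (\<Sum>p\<in>{p \<in> splits E u v W. fst p \<union> snd p \<noteq> W}. g p W)"
    by (simp add: sum.inter_filter[symmetric] sum_distrib_left)
  also have "{p \<in> splits E u v W. fst p \<union> snd p \<noteq> W} =
      {(S1, S2). (S1, S2) \<in> splits E u v W \<and> S1 \<union> S2 \<noteq> W}"
    by auto
  finally show ?thesis
    by (simp add: g_def case_prod_unfold)
qed

text \<open>
  Both sides satisfy the same recursion over removed sets, by induction on $|W|$. If $W$ is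
  disconnected in the new graph, both sides factor. If $W$ is connected in the old graph, its recursion
  is the one of the new graph. The remaining case is a new edge that joins two components: there the
  old polynomial obeys a recursion with the factor $(x+t)^2$ instead of $x+t$, and the
  discrepancy is the summand of the single split with $S_1 \cup S_2 = W$.
\<close>

theorem nest_poly_add_edge:
  fixes x t :: "'r::idom"
  assumes "sym E" "x \<noteq> 0"
  shows "t * (nest_poly x t (add_edge E u v) W - nest_poly x t E W) = (x + t) * split_sum x t E u v W"
proof (induction "card W" arbitrary: W rule: less_induct)
  case less
  let ?E' = "add_edge E u v" and ?T = "nest_poly x t E" and ?T' = "nest_poly x t (add_edge E u v)"
  let ?R = "split_sum x t E u v"
  show ?case
  proof (cases "u \<in> W \<and> v \<in> W")
    case False
    then have out: "u \<notin> W \<or> v \<notin> W" by blast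
    show ?thesis
      by (simp add: nest_poly_add_edge_outside[OF out] split_sum_outside[OF out])
  next
    case uv: True
    show ?thesis
    proof (cases "conn ?E' W")
      case False
      obtain A B where AB: "W = A \<union> B" "u \<in> A" "B \<noteq> {}" "separated ?E' A B"
        using False conjunct1[OF uv] sym_add_edge[OF assms(1)] by (rule not_connE)
      have v: "v \<in> A"
        using AB uv by (auto simp: separated_def add_edge_def)
      have nB: "u \<notin> B" using AB by (auto simp: separated_def)
      have "A \<subset> W" using AB by (auto simp: separated_def)
      then have "card A < card W" by (simp add: psubset_card_mono)
      then have IH: "t * (?T' A - ?T A) = (x + t) * ?R A"
        by (rule less)
      have "?T' W = ?T' A * ?T B" "?T W = ?T A * ?T B"
        using nest_poly_separated[OF AB(4), of x t] nest_poly_separated[OF separated_add_edge[OF AB(4)], of x t]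
          nest_poly_add_edge_outside[of u B v x t E] nB AB(1) by simp_all
      moreover have "?R W = ?R A * ?T B"
        unfolding AB(1) by (rule split_sum_separated[OF AB(4,2) v])
      ultimately have "t * (?T' W - ?T W) = (t * (?T' A - ?T A)) * ?T B"
          "(x + t) * ?R W = ((x + t) * ?R A) * ?T B"
        by (simp_all only: algebra_simps)
      then show ?thesis by (simp only: IH)
    next
      case conn': True
      define P where "P = (\<Sum>M | M \<subseteq> W \<and> M \<noteq> {}. x ^ card M * ?T (W - M))"
      define P' where "P' = (\<Sum>M | M \<subseteq> W \<and> M \<noteq> {}. x ^ card M * ?T' (W - M))"
      define Q where "Q = (\<Sum>M | M \<subseteq> W \<and> M \<noteq> {}. x ^ card M * ?R (W - M))"
      define R' where "R' = (\<Sum>(S1, S2) | (S1, S2) \<in> splits E u v W \<and> S1 \<union> S2 \<noteq> W.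
        ?T S1 * ?T S2 * nest_poly x t (contract ?E' (S1 \<union> S2)) (W - (S1 \<union> S2)))"
      have P': "x * ?T' W = t * P'"
        unfolding P'_def by (rule removal_sum_conn[OF conn'])
      have Q: "t * Q = x * R'"
        unfolding Q_def R'_def by (rule removal_sum_split_sum[OF conn' assms(1)])
      have "t * (P' - P) = (\<Sum>M | M \<subseteq> W \<and> M \<noteq> {}. x ^ card M * (t * (?T' (W - M) - ?T (W - M))))"
        by (simp add: P_def P'_def sum_subtractf[symmetric] sum_distrib_left algebra_simps)
      also have "\<dots> = (\<Sum>M | M \<subseteq> W \<and> M \<noteq> {}. x ^ card M * ((x + t) * ?R (W - M)))"
      proof (rule sum.cong[OF refl])
        fix M assume "M \<in> {M. M \<subseteq> W \<and> M \<noteq> {}}"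
        then have "W - M \<subset> W" by auto
        then have "card (W - M) < card W" by (simp add: psubset_card_mono)
        from less[OF this] show "x ^ card M * (t * (?T' (W - M) - ?T (W - M))) =
            x ^ card M * ((x + t) * ?R (W - M))" by simp
      qed
      finally have PQ: "t * (P' - P) = (x + t) * Q"
        by (simp add: Q_def sum_distrib_left algebra_simps)
      have "x * (t * (?T' W - ?T W)) = x * ((x + t) * ?R W)"
      proof (cases "conn E W")
        case True
        have "S1 \<union> S2 \<noteq> W" if "(S1, S2) \<in> splits E u v W" for S1 S2
        proof
          assume W: "S1 \<union> S2 = W"
          have "W \<subseteq> S1"
            using that True W by (intro conn_separated_mem[of E W S1 S2 u]) (auto simp: splits_def)
          then show False
            using that W by (auto simp: splits_def separated_def)
        qed
        then have "{(S1, S2). (S1, S2) \<in> splits E u v W \<and> S1 \<union> S2 \<noteq> W} = splits E u v W"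
          by auto
        then have "R' = ?R W"
          by (simp add: R'_def split_sum_def)
        moreover have "x * ?T W = t * P"
          unfolding P_def by (rule removal_sum_conn[OF True])
        moreover have "x * (t * (?T' W - ?T W)) = t * (x * ?T' W) - t * (x * ?T W)"
          by (simp only: algebra_simps)
        ultimately have "x * (t * (?T' W - ?T W)) = t * (t * (P' - P))" "t * Q = x * ?R W"
          using P' Q by (simp_all add: right_diff_distrib)
        then show ?thesis
          unfolding PQ by (metis mult.left_commute)
      next
        case False
        obtain A B where AB: "W = A \<union> B" "u \<in> A" "B \<noteq> {}" "separated E A B"
          using False conjunct1[OF uv] assms(1) by (rule not_connE)
        have vB: "v \<in> B"
        proof (rule ccontr)
          assume "v \<notin> B"
          then have "v \<in> A" using uv AB by auto
          then have "separated ?E' A B"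
            using AB by (auto simp: separated_def add_edge_def)
          then have "W \<subseteq> A"
            using conn_separated_mem[OF conn'] uv AB by blast
          then show False
            using AB by (auto simp: separated_def)
        qed
        have cA: "conn E A"
        proof (rule ccontr)
          assume "\<not> conn E A"
          then obtain C D where CD: "A = C \<union> D" "u \<in> C" "D \<noteq> {}" "separated E C D"
            using AB(2) assms(1) by (rule not_connE)
          have "separated ?E' (C \<union> B) D"
            using CD AB vB by (auto simp: separated_def add_edge_def)
          then have "W \<subseteq> C \<union> B"
            using conn_separated_mem[OF conn', of "C \<union> B" D u] CD AB by blast
          then show False
            using CD AB by (auto simp: separated_def)
        qed
        have cB: "conn E B"
        proof (rule ccontr)
          assume "\<not> conn E B"
          then obtain C D where CD: "B = C \<union> D" "v \<in> C" "D \<noteq> {}" "separated E C D"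
            using vB assms(1) by (rule not_connE)
          have "separated ?E' (C \<union> A) D"
            using CD AB vB by (auto simp: separated_def add_edge_def)
          then have "W \<subseteq> C \<union> A"
            using conn_separated_mem[OF conn', of "C \<union> A" D u] CD AB by blast
          then show False
            using CD AB by (auto simp: separated_def)
        qed
        have only: "S1 = A \<and> S2 = B" if "(S1, S2) \<in> splits E u v W" "S1 \<union> S2 = W" for S1 S2
        proof -
          have s: "conn E S1" "conn E S2" "u \<in> S1" "v \<in> S2" "S1 \<inter> S2 = {}"
            using that by (auto simp: splits_def separated_def)
          have "S1 \<subseteq> A"
            using conn_separated_mem[OF s(1) _ AB(4) s(3) AB(2)] that AB(1) by blast
          moreover have "S2 \<subseteq> B"
            using conn_separated_mem[OF s(2) _ separated_sym[OF AB(4)] s(4) vB] that AB(1) by blast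
          ultimately show ?thesis
            using that AB by (auto simp: separated_def)
        qed
        have "(A, B) \<in> splits E u v W"
          using AB cA cB vB by (auto simp: splits_def)
        then have "p \<in> splits E u v W \<longleftrightarrow>
            p = (A, B) \<or> p \<in> splits E u v W \<and> fst p \<union> snd p \<noteq> W" for p
          using only[of "fst p" "snd p"] by (cases p) auto
        then have eq: "splits E u v W =
            insert (A, B) {(S1, S2). (S1, S2) \<in> splits E u v W \<and> S1 \<union> S2 \<noteq> W}"
          by (intro set_eqI) (simp only: insert_iff mem_Collect_eq case_prod_unfold prod.collapse)
        have "?R W = (\<Sum>(S1, S2)\<in>insert (A, B) {(S1, S2). (S1, S2) \<in> splits E u v W \<and> S1 \<union> S2 \<noteq> W}.
            ?T S1 * ?T S2 * nest_poly x t (contract ?E' (S1 \<union> S2)) (W - (S1 \<union> S2)))"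
          unfolding split_sum_def by (subst eq) (rule refl)
        also have "\<dots> = ?T A * ?T B + R'"
          by (subst sum.insert) (auto simp: R'_def AB(1))
        finally have R: "?R W = ?T W + R'"
          using nest_poly_separated[OF AB(4), of x t] AB(1) by simp
        \<comment> \<open>Both components contribute a factor to the recursion of the old graph.\<close>
        have full: "t * t * (P + ?T W) = (x + t) * (x + t) * ?T W"
        proof -
          have "P + ?T W = (\<Sum>M | M \<subseteq> W. x ^ card M * ?T (W - M))"
            by (simp add: P_def sum_all_subsets)
          then have "t * t * (P + ?T W) =
              (t * (\<Sum>M | M \<subseteq> A. x ^ card M * ?T (A - M))) * (t * (\<Sum>M | M \<subseteq> B. x ^ card M * ?T (B - M)))"
            unfolding AB(1) removal_sum_all_separated[OF AB(4), of x t] by (simp only: mult_ac)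
          then show ?thesis
            unfolding removal_sum_all_conn[OF cA, of t x] removal_sum_all_conn[OF cB, of t x]
            unfolding AB(1) nest_poly_separated[OF AB(4), of x t] by (simp only: mult_ac)
        qed
        have "x * (t * (?T' W - ?T W)) =
            t * (x * ?T' W) - t * (t * P') + t * (t * (P' - P)) + t * t * (P + ?T W) - t * t * ?T W - x * t * ?T W"
          by (simp only: algebra_simps)
        also have "\<dots> = (x + t) * (t * Q) + (x + t) * (x + t) * ?T W - t * t * ?T W - x * t * ?T W"
          unfolding P' PQ full by (simp add: mult.left_commute)
        also have "\<dots> = x * ((x + t) * (?T W + R'))"
          unfolding Q by (simp only: algebra_simps)
        finally show ?thesis
          by (simp only: R)
      qed
      then show ?thesis
        by (rule iffD1[OF mult_left_cancel[OF assms(2)]])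
    qed
  qed
qed

section \<open>The h-polynomial of a graph\<close>

text \<open>
  For nonempty $W$ this is \<open>nest_poly\<close> at $x = \alpha - t$ divided by $t$. Since then $x + t = \alpha$, the
  edge formula becomes symmetric in $\alpha$ and $t$.
\<close>

definition hpoly :: "'v::finite rel \<Rightarrow> 'v set \<Rightarrow> int poly poly" where
  "hpoly E W = (\<Sum>N\<in>nests E W. (alpha_var - t_var) ^ (card W - card N) * t_var ^ (card N - 1))"

abbreviation npoly :: "'v::finite rel \<Rightarrow> 'v set \<Rightarrow> int poly poly" where
  "npoly \<equiv> nest_poly (alpha_var - t_var) t_var"

lemma t_var_nonzero: "t_var \<noteq> 0"
  by (simp add: t_var_def)

lemma alpha_minus_t_nonzero: "alpha_var - t_var \<noteq> 0"
  by (simp add: t_var_def alpha_var_def)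

lemma npoly_hpoly:
  assumes "W \<noteq> {}"
  shows "npoly E W = t_var * hpoly E W"
  unfolding nest_poly_def hpoly_def sum_distrib_left
proof (rule sum.cong[OF refl])
  fix N assume "N \<in> nests E W"
  then have "N \<noteq> {}"
    using Union_nest assms by fastforce
  then have "card N = Suc (card N - 1)"
    by (simp add: card_gt_0_iff)
  then have "t_var ^ card N = t_var * t_var ^ (card N - 1)"
    by (metis power_Suc)
  then show "(alpha_var - t_var) ^ (card W - card N) * t_var ^ card N =
      t_var * ((alpha_var - t_var) ^ (card W - card N) * t_var ^ (card N - 1))"
    by (simp only: mult_ac)
qed

lemma hpoly_cong:
  assumes "E \<inter> W \<times> W = E' \<inter> W \<times> W"
  shows "hpoly E W = hpoly E' W"
  unfolding hpoly_def nests_cong[OF assms] ..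

lemma npoly_singleton: "npoly E {v} = t_var"
proof -
  have "{M. M \<subseteq> {v} \<and> M \<noteq> {}} = {{v}}" by auto
  then show ?thesis
    by (simp add: nest_poly_conn[OF conn_singleton])
qed

lemma hpoly_singleton: "hpoly E {v} = 1"
  using npoly_hpoly[of "{v}" E] t_var_nonzero by (simp add: npoly_singleton)

text \<open>
  Every summand of \<open>split_sum\<close> has three nonempty vertex sets as arguments, because a connected set $W$ is not the
  union of two separated parts. This gives the factor $t^3$, of which two powers cancel.
\<close>

theorem hpoly_add_edge:
  assumes "sym E" "conn E W"
  shows "hpoly (add_edge E u v) W = hpoly E W + alpha_var * t_var *
    (\<Sum>(S1, S2)\<in>splits E u v W. hpoly E S1 * hpoly E S2 *
       hpoly (contract (add_edge E u v) (S1 \<union> S2)) (W - (S1 \<union> S2)))"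
proof -
  let ?h = "\<lambda>(S1, S2). hpoly E S1 * hpoly E S2 *
       hpoly (contract (add_edge E u v) (S1 \<union> S2)) (W - (S1 \<union> S2))"
  have W: "W \<noteq> {}" using assms(2) conn_nonempty by blast
  have "split_sum (alpha_var - t_var) t_var E u v W = t_var ^ 3 * (\<Sum>p\<in>splits E u v W. ?h p)"
    unfolding split_sum_def sum_distrib_left
  proof (rule sum.cong[OF refl], clarify)
    fix S1 S2 assume S: "(S1, S2) \<in> splits E u v W"
    then have ne: "S1 \<noteq> {}" "S2 \<noteq> {}" by (auto simp: splits_def)
    have "S1 \<union> S2 \<noteq> W"
    proof
      assume eq: "S1 \<union> S2 = W"
      have "W \<subseteq> S1"
        using S assms(2) eq by (intro conn_separated_mem[of E W S1 S2 u]) (auto simp: splits_def)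
      then show False
        using S eq by (auto simp: splits_def separated_def)
    qed
    then have "W - (S1 \<union> S2) \<noteq> {}"
      using S by (auto simp: splits_def)
    then show "npoly E S1 * npoly E S2 * npoly (contract (add_edge E u v) (S1 \<union> S2)) (W - (S1 \<union> S2)) =
        t_var ^ 3 * (hpoly E S1 * hpoly E S2 *
          hpoly (contract (add_edge E u v) (S1 \<union> S2)) (W - (S1 \<union> S2)))"
      using ne by (simp only: npoly_hpoly not_False_eq_True) (simp only: power3_eq_cube mult_ac)
  qed
  then have "t_var * (npoly (add_edge E u v) W - npoly E W) = alpha_var * (t_var ^ 3 * (\<Sum>p\<in>splits E u v W. ?h p))"
    using nest_poly_add_edge[OF assms(1) alpha_minus_t_nonzero, of t_var u v W] by simp
  then have "t_var ^ 2 * (hpoly (add_edge E u v) W - hpoly E W) =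
      t_var ^ 2 * (alpha_var * t_var * (\<Sum>p\<in>splits E u v W. ?h p))"
    unfolding npoly_hpoly[OF W] by (simp add: algebra_simps power2_eq_square power3_eq_cube)
  then have "hpoly (add_edge E u v) W - hpoly E W = alpha_var * t_var * (\<Sum>p\<in>splits E u v W. ?h p)"
    using t_var_nonzero by simp
  then show ?thesis
    by (simp add: algebra_simps)
qed

text \<open>
  Before the edge is added, $v$ is isolated, so the only split part containing $v$ is $\{v\}$. The split
  with $S = U$ leaves nothing to contract and produces the term $\alpha H(U)$; the missing $t\,H(U)$
  comes from the graph without the edge.
\<close>

theorem hpoly_add_leaf:
  assumes "sym E" "conn E U" "u \<in> U" "v \<notin> U" "\<And>w. w \<in> U \<Longrightarrow> (v, w) \<notin> E"
  shows "hpoly (add_edge E v u) (insert v U) = (alpha_var + t_var) * hpoly E U + alpha_var * t_var *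
    (\<Sum>S | conn E S \<and> u \<in> S \<and> S \<subset> U.
       hpoly E S * hpoly (contract (add_edge E v u) (insert v S)) (U - S))"
proof -
  let ?W = "insert v U" and ?E' = "add_edge E v u"
  let ?h = "\<lambda>S. hpoly E S * hpoly (contract ?E' (insert v S)) (U - S)"
  have sep: "separated E {v} U"
    using assms(1,4,5) by (auto simp: separated_def dest: symD)
  have U: "U \<noteq> {}" using assms(3) by blast
  define \<S> where "\<S> = {S. conn E S \<and> u \<in> S \<and> S \<subset> U}"
  have spl: "splits E v u ?W = (\<lambda>S. ({v}, S)) ` insert U \<S>"
  proof (intro equalityI subsetI)
    fix p assume "p \<in> splits E v u ?W"
    then obtain S1 S2 where p: "p = (S1, S2)" "conn E S1" "conn E S2" "separated E S1 S2"
      "v \<in> S1" "u \<in> S2" "S1 \<subseteq> {v} \<union> U" "S2 \<subseteq> U \<union> {v}"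
      by (auto simp: splits_def)
    have "S1 \<subseteq> {v}"
      using conn_separated_mem[OF p(2,7) sep p(5)] by simp
    moreover have "S2 \<subseteq> U"
      using conn_separated_mem[OF p(3,8) separated_sym[OF sep] p(6) assms(3)] .
    ultimately show "p \<in> (\<lambda>S. ({v}, S)) ` insert U \<S>"
      using p(1,3,5,6) by (auto simp: \<S>_def)
  next
    fix p assume "p \<in> (\<lambda>S. ({v}, S)) ` insert U \<S>"
    then obtain S where S: "p = ({v}, S)" "S \<subseteq> U" "conn E S" "u \<in> S"
      using assms(2,3) by (auto simp: \<S>_def)
    have "separated E {v} S"
      using separated_subset[OF sep _ S(2)] by blast
    then show "p \<in> splits E v u ?W"
      using S by (auto simp: splits_def conn_singleton)
  qed
  have "split_sum (alpha_var - t_var) t_var E v u ?W =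
      (\<Sum>S\<in>insert U \<S>. t_var * npoly E S * npoly (contract ?E' (insert v S)) (U - S))"
  proof -
    have "?W - ({v} \<union> S) = U - S" for S
      using assms(4) by blast
    then show ?thesis
      unfolding split_sum_def spl by (subst sum.reindex) (auto simp: inj_on_def npoly_singleton)
  qed
  also have "\<dots> = t_var * npoly E U + (\<Sum>S\<in>\<S>. t_var * npoly E S * npoly (contract ?E' (insert v S)) (U - S))"
    by (subst sum.insert) (auto simp: \<S>_def)
  also have "(\<Sum>S\<in>\<S>. t_var * npoly E S * npoly (contract ?E' (insert v S)) (U - S)) =
      t_var ^ 3 * (\<Sum>S\<in>\<S>. ?h S)"
    unfolding sum_distrib_left
  proof (rule sum.cong[OF refl])
    fix S assume "S \<in> \<S>"
    then have "S \<noteq> {}" "U - S \<noteq> {}"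
      by (auto simp: \<S>_def)
    then show "t_var * npoly E S * npoly (contract ?E' (insert v S)) (U - S) = t_var ^ 3 * ?h S"
      by (simp only: npoly_hpoly not_False_eq_True) (simp only: power3_eq_cube mult_ac)
  qed
  finally have "t_var * (npoly ?E' ?W - npoly E ?W) =
      alpha_var * (t_var * npoly E U + t_var ^ 3 * (\<Sum>S\<in>\<S>. ?h S))"
    using nest_poly_add_edge[OF assms(1) alpha_minus_t_nonzero, of t_var v u ?W] by simp
  moreover have "npoly E ?W = t_var * npoly E U"
    using nest_poly_separated[OF sep, of "alpha_var - t_var" t_var] by (simp add: npoly_singleton)
  ultimately have "t_var ^ 2 * hpoly ?E' ?W =
      t_var ^ 2 * ((alpha_var + t_var) * hpoly E U + alpha_var * t_var * (\<Sum>S\<in>\<S>. ?h S))"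
    unfolding npoly_hpoly[OF U] npoly_hpoly[OF insert_not_empty]
    by (simp add: algebra_simps power2_eq_square power3_eq_cube)
  then show ?thesis
    using t_var_nonzero by (simp add: \<S>_def)
qed

section \<open>Polynomials with nonnegative gamma-coefficients\<close>

definition gamma_sum :: "nat \<Rightarrow> (nat \<Rightarrow> int) \<Rightarrow> int poly poly" where
  "gamma_sum n c = (\<Sum>i\<le>n div 2. of_int (c i) * (alpha_var * t_var) ^ i * (alpha_var + t_var) ^ (n - 2 * i))"

text \<open>
  The condition beyond $n/2$ fixes the coefficients that \<open>gamma_sum\<close> ignores, in accordance with the
  padding in \<open>gamma_num\<close>.
\<close>

definition gamma_cone :: "nat \<Rightarrow> int poly poly set" where
  "gamma_cone n = {gamma_sum n c | c. (\<forall>i. 0 \<le> c i) \<and> (\<forall>i > n div 2. c i = 0)}"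

lemma gamma_coneE:
  assumes "p \<in> gamma_cone n"
  obtains c where "p = gamma_sum n c" "\<And>i. 0 \<le> c i" "\<And>i. i > n div 2 \<Longrightarrow> c i = 0"
  using assms unfolding gamma_cone_def by blast

lemma gamma_coneI:
  assumes "p = gamma_sum n c" "\<And>i. 0 \<le> c i" "\<And>i. i > n div 2 \<Longrightarrow> c i = 0"
  shows "p \<in> gamma_cone n"
  using assms unfolding gamma_cone_def by blast

lemma gamma_cone_0 [simp]: "0 \<in> gamma_cone n"
  by (rule gamma_coneI[of _ _ "\<lambda>_. 0"]) (auto simp: gamma_sum_def)

lemma gamma_cone_1: "1 \<in> gamma_cone 0"
  by (rule gamma_coneI[of _ _ "\<lambda>i. if i = 0 then 1 else 0"]) (auto simp: gamma_sum_def)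

lemma gamma_cone_add: "p \<in> gamma_cone n \<Longrightarrow> q \<in> gamma_cone n \<Longrightarrow> p + q \<in> gamma_cone n"
proof (elim gamma_coneE)
  fix c d assume "p = gamma_sum n c" "\<And>i. 0 \<le> c i" "\<And>i. i > n div 2 \<Longrightarrow> c i = 0"
    "q = gamma_sum n d" "\<And>i. 0 \<le> d i" "\<And>i. i > n div 2 \<Longrightarrow> d i = 0"
  then show ?thesis
    by (intro gamma_coneI[of _ _ "\<lambda>i. c i + d i"])
      (simp_all add: gamma_sum_def sum.distrib[symmetric] algebra_simps)
qed

lemma gamma_cone_sum: "(\<And>i. i \<in> I \<Longrightarrow> f i \<in> gamma_cone n) \<Longrightarrow> sum f I \<in> gamma_cone n"
  by (induction I rule: infinite_finite_induct) (auto intro: gamma_cone_add)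

lemma gamma_cone_scale:
  assumes "p \<in> gamma_cone n" "0 \<le> k"
  shows "of_int k * p \<in> gamma_cone n"
  using assms(1)
proof (rule gamma_coneE)
  fix c assume "p = gamma_sum n c" "\<And>i. 0 \<le> c i" "\<And>i. i > n div 2 \<Longrightarrow> c i = 0"
  then show ?thesis
    using assms(2) by (intro gamma_coneI[of _ _ "\<lambda>i. k * c i"])
      (simp_all add: gamma_sum_def sum_distrib_left mult.assoc)
qed

lemma gamma_cone_times_alpha_plus_t:
  assumes "p \<in> gamma_cone n"
  shows "(alpha_var + t_var) * p \<in> gamma_cone (Suc n)"
  using assms
proof (rule gamma_coneE)
  fix c assume c: "p = gamma_sum n c" "\<And>i. 0 \<le> c i" "\<And>i. i > n div 2 \<Longrightarrow> c i = 0"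
  have "(alpha_var + t_var) * p = (\<Sum>i\<le>n div 2.
      of_int (c i) * (alpha_var * t_var) ^ i * (alpha_var + t_var) ^ (Suc n - 2 * i))"
    unfolding c(1) gamma_sum_def sum_distrib_left
  proof (rule sum.cong[OF refl])
    fix i assume "i \<in> {..n div 2}"
    then have "Suc n - 2 * i = Suc (n - 2 * i)" by auto
    then show "(alpha_var + t_var) * (of_int (c i) * (alpha_var * t_var) ^ i * (alpha_var + t_var) ^ (n - 2 * i)) =
        of_int (c i) * (alpha_var * t_var) ^ i * (alpha_var + t_var) ^ (Suc n - 2 * i)"
      by (simp only: power_Suc mult_ac)
  qed
  also have "\<dots> = gamma_sum (Suc n) c"
    unfolding gamma_sum_def by (rule sum.mono_neutral_left) (auto simp: c(3) div_le_mono)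
  finally show ?thesis
    by (rule gamma_coneI) (use c in auto)
qed

lemma gamma_cone_times_alpha_t:
  assumes "p \<in> gamma_cone n"
  shows "alpha_var * t_var * p \<in> gamma_cone (Suc (Suc n))"
  using assms
proof (rule gamma_coneE)
  fix c assume c: "p = gamma_sum n c" "\<And>i. 0 \<le> c i" "\<And>i. i > n div 2 \<Longrightarrow> c i = 0"
  define d where "d i = (case i of 0 \<Rightarrow> 0 | Suc j \<Rightarrow> c j)" for i
  have "gamma_sum (Suc (Suc n)) d = (\<Sum>i\<le>Suc (n div 2).
      of_int (d i) * (alpha_var * t_var) ^ i * (alpha_var + t_var) ^ (Suc (Suc n) - 2 * i))"
    by (simp add: gamma_sum_def)
  also have "\<dots> = (\<Sum>i\<le>n div 2.
      of_int (c i) * (alpha_var * t_var) ^ Suc i * (alpha_var + t_var) ^ (n - 2 * i))"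
    by (subst sum.atMost_Suc_shift) (simp add: d_def)
  also have "\<dots> = alpha_var * t_var * p"
    unfolding c(1) gamma_sum_def sum_distrib_left by (simp only: power_Suc mult_ac)
  finally have "alpha_var * t_var * p = gamma_sum (Suc (Suc n)) d" ..
  then show ?thesis
    by (rule gamma_coneI) (use c in \<open>auto simp: d_def split: nat.splits\<close>)
qed

lemma gamma_cone_mult:
  assumes "p \<in> gamma_cone n" "q \<in> gamma_cone m"
  shows "p * q \<in> gamma_cone (n + m)"
  using assms(1)
proof (rule gamma_coneE)
  fix c assume c: "p = gamma_sum n c" "\<And>i. 0 \<le> c i" "\<And>i. i > n div 2 \<Longrightarrow> c i = 0"
  have s: "(alpha_var + t_var) ^ j * q \<in> gamma_cone (j + m)" for j
    by (induction j) (use assms(2) in \<open>auto simp: mult.assoc intro: gamma_cone_times_alpha_plus_t\<close>)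
  have st: "(alpha_var * t_var) ^ i * ((alpha_var + t_var) ^ j * q) \<in> gamma_cone (2 * i + j + m)" for i j
    by (induction i) (use s[of j] in \<open>auto simp: mult.assoc dest: gamma_cone_times_alpha_t\<close>)
  have "of_int (c i) * ((alpha_var * t_var) ^ i * ((alpha_var + t_var) ^ (n - 2 * i) * q)) \<in> gamma_cone (n + m)"
    if "i \<le> n div 2" for i
  proof -
    have "2 * i + (n - 2 * i) + m = n + m" using that by auto
    then show ?thesis
      using gamma_cone_scale[OF st[of i "n - 2 * i"] c(2)[of i]] by simp
  qed
  then have "(\<Sum>i\<le>n div 2. of_int (c i) * ((alpha_var * t_var) ^ i * ((alpha_var + t_var) ^ (n - 2 * i) * q))) \<in> gamma_cone (n + m)"
    by (intro gamma_cone_sum) auto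
  also have "(\<Sum>i\<le>n div 2. of_int (c i) * ((alpha_var * t_var) ^ i * ((alpha_var + t_var) ^ (n - 2 * i) * q))) = p * q"
    by (simp add: c(1) gamma_sum_def sum_distrib_right mult.assoc)
  finally show ?thesis .
qed

section \<open>Comparison of the h-polynomials\<close>

text \<open>
  A connected set containing $u$ grows one vertex at a time along an edge that leaves it.
\<close>

lemma conn_subset_of_card:
  fixes U :: "'v::finite set"
  assumes "sym E" "conn E U" "u \<in> U" "1 \<le> k" "k \<le> card U"
  shows "\<exists>S. conn E S \<and> u \<in> S \<and> S \<subseteq> U \<and> card S = k"
  using assms(4,5)
proof (induction k rule: dec_induct)
  case base
  then show ?case
    using assms(3) by (intro exI[of _ "{u}"]) (auto simp: conn_singleton)
next
  case (step k)
  then obtain S where S: "conn E S" "u \<in> S" "S \<subseteq> U" "card S = k"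
    by auto
  then have "S \<noteq> {}" "S \<noteq> U"
    using step by auto
  with assms(2) S(3) obtain a b where ab: "a \<in> S" "b \<in> U - S" "(a, b) \<in> E"
    by (rule connE)
  have "conn E (insert b S)"
    using S(1) ab(1,3) assms(1) by (rule conn_insert)
  then show ?case
    using S ab by (intro exI[of _ "insert b S"]) auto
qed

text \<open>
  The vertex missing from a connected subset with one element less is the required one.
\<close>

lemma conn_non_cut_vertex:
  fixes W :: "'v::finite set"
  assumes "sym E" "conn E W" "2 \<le> card W"
  obtains u v U where "W = insert v U" "v \<notin> U" "u \<in> U" "conn E U" "(u, v) \<in> E"
proof -
  obtain w where w: "w \<in> W"
    using conn_nonempty[OF assms(2)] by blast
  have "1 \<le> card W - 1" "card W - 1 \<le> card W"
    using assms(3) by auto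
  from conn_subset_of_card[OF assms(1,2) w this]
  obtain U where U: "conn E U" "U \<subseteq> W" "card U = card W - 1"
    by blast
  have ne: "U \<noteq> {}" "U \<noteq> W"
    using U assms(3) by auto
  with assms(2) U(2) obtain u v where uv: "u \<in> U" "v \<in> W - U" "(u, v) \<in> E"
    by (rule connE)
  have "insert v U = W"
    using U uv assms(3) by (intro card_subset_eq) auto
  then show thesis
    using that[of v U u] U uv by auto
qed

lemma irrefl_contract: "irrefl E \<Longrightarrow> irrefl (contract E S)"
  by (auto simp: irrefl_def contract_def)

lemma irrefl_add_edge: "irrefl E \<Longrightarrow> u \<noteq> v \<Longrightarrow> irrefl (add_edge E u v)"
  by (auto simp: irrefl_def add_edge_def)

text \<open>
  The assumption on smaller sets is the induction hypothesis of \<open>hpoly_ge_path\<close>; it covers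
  the three factors of each summand in the edge formula, whose vertex sets partition $W$.
\<close>

lemma hpoly_add_edge_gamma:
  fixes W :: "'v::finite set"
  assumes pos: "\<And>(D :: 'v rel) S. sym D \<Longrightarrow> irrefl D \<Longrightarrow> conn D S \<Longrightarrow> card S < card W \<Longrightarrow>
      hpoly D S \<in> gamma_cone (card S - 1)"
    and "sym E" "irrefl E" "conn E W" "u \<noteq> v"
  shows "hpoly (add_edge E u v) W - hpoly E W \<in> gamma_cone (card W - 1)"
proof -
  have "hpoly E S1 * hpoly E S2 * hpoly (contract (add_edge E u v) (S1 \<union> S2)) (W - (S1 \<union> S2))
      \<in> gamma_cone (card W - 3) \<and> 3 \<le> card W" if S: "(S1, S2) \<in> splits E u v W" for S1 S2
  proof -
    let ?S = "S1 \<union> S2" and ?C = "contract (add_edge E u v) (S1 \<union> S2)"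
    have s: "conn E S1" "conn E S2" "S1 \<inter> S2 = {}" "?S \<subseteq> W" "u \<in> S1" "v \<in> S2" "separated E S1 S2"
      using S by (auto simp: splits_def separated_def)
    have neq: "?S \<noteq> W"
    proof
      assume eq: "?S = W"
      have "W \<subseteq> S1"
        by (rule conn_separated_mem[OF assms(4) _ s(7) _ s(5)]) (use eq s(4,5) in auto)
      then show False
        using s(3,6) eq by blast
    qed
    have conn': "conn (add_edge E u v) W"
      using assms(4) by (rule conn_mono) (auto simp: add_edge_def)
    have c: "conn ?C (W - ?S)"
      using conn' sym_add_edge[OF assms(2)] s(4) neq by (rule conn_contract)
    have ne: "S1 \<noteq> {}" "S2 \<noteq> {}" "W - ?S \<noteq> {}"
      using s neq by auto
    then have card_pos: "0 < card S1" "0 < card S2" "0 < card (W - ?S)"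
      by (simp_all add: card_gt_0_iff)
    have cardS: "card ?S = card S1 + card S2"
      using s(3) by (simp add: card_Un_disjoint)
    moreover have "card ?S \<le> card W"
      using s(4) by (simp add: card_mono)
    moreover have "card (W - ?S) = card W - card ?S"
      using s(4) by (simp add: card_Diff_subset)
    ultimately have cards: "card W = card S1 + card S2 + card (W - ?S)"
      by simp
    have less: "card S1 < card W" "card S2 < card W" "card (W - ?S) < card W"
      using cards card_pos by linarith+
    have 1: "hpoly E S1 \<in> gamma_cone (card S1 - 1)"
      using assms(2,3) s(1) less(1) by (rule pos)
    have 2: "hpoly E S2 \<in> gamma_cone (card S2 - 1)"
      using assms(2,3) s(2) less(2) by (rule pos)
    have 3: "hpoly ?C (W - ?S) \<in> gamma_cone (card (W - ?S) - 1)"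
      using sym_contract[OF sym_add_edge[OF assms(2)]]
        irrefl_contract[OF irrefl_add_edge[OF assms(3,5)]] c less(3) by (rule pos)
    have "card S1 - 1 + (card S2 - 1) + (card (W - ?S) - 1) = card W - 3"
      using cards card_pos by linarith
    moreover have "3 \<le> card W"
      using cards card_pos by linarith
    ultimately show ?thesis
      using gamma_cone_mult[OF gamma_cone_mult[OF 1 2] 3] by simp
  qed
  note g = this
  have "alpha_var * t_var * (\<Sum>(S1, S2)\<in>splits E u v W. hpoly E S1 * hpoly E S2 *
       hpoly (contract (add_edge E u v) (S1 \<union> S2)) (W - (S1 \<union> S2))) \<in> gamma_cone (card W - 1)"
  proof (cases "splits E u v W = {}")
    case True
    then show ?thesis by simp
  next
    case False
    then obtain S1 S2 where "(S1, S2) \<in> splits E u v W"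
      by (metis equals0I surj_pair)
    then have "Suc (Suc (card W - 3)) = card W - 1"
      using g[of S1 S2] by linarith
    moreover have "(\<Sum>(S1, S2)\<in>splits E u v W. hpoly E S1 * hpoly E S2 *
       hpoly (contract (add_edge E u v) (S1 \<union> S2)) (W - (S1 \<union> S2))) \<in> gamma_cone (card W - 3)"
      by (rule gamma_cone_sum) (use g in auto)
    ultimately show ?thesis
      using gamma_cone_times_alpha_t[of _ "card W - 3"] by simp
  qed
  then show ?thesis
    using hpoly_add_edge[OF assms(2,4), of u v] by simp
qed

lemma hpoly_mono_gamma:
  fixes W :: "'v::finite set"
  assumes pos: "\<And>(D :: 'v rel) S. sym D \<Longrightarrow> irrefl D \<Longrightarrow> conn D S \<Longrightarrow> card S < card W \<Longrightarrow>
      hpoly D S \<in> gamma_cone (card S - 1)"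
    and "sym E'" "irrefl E'"
  shows "sym E \<Longrightarrow> E \<subseteq> E' \<Longrightarrow> conn E W \<Longrightarrow> hpoly E' W - hpoly E W \<in> gamma_cone (card W - 1)"
proof (induction "card ((E' - E) \<inter> W \<times> W)" arbitrary: E rule: less_induct)
  case less
  show ?case
  proof (cases "(E' - E) \<inter> W \<times> W = {}")
    case True
    then have "E \<inter> W \<times> W = E' \<inter> W \<times> W"
      using less.prems(2) by blast
    then have "hpoly E' W = hpoly E W"
      by (simp only: hpoly_cong[of E W E'])
    then show ?thesis by simp
  next
    case False
    then obtain u v where uv: "(u, v) \<in> E'" "(u, v) \<notin> E" "u \<in> W" "v \<in> W" by auto
    have "u \<noteq> v"
      using uv(1) assms(3) by (auto simp: irrefl_def)
    have "irrefl E"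
      using assms(3) less.prems(2) by (auto simp: irrefl_def)
    let ?E1 = "add_edge E u v"
    have E1: "?E1 \<subseteq> E'"
      using uv(1) less.prems(2) assms(2) by (auto simp: add_edge_def dest: symD)
    have "(E' - ?E1) \<inter> W \<times> W \<subset> (E' - E) \<inter> W \<times> W"
      using uv by (auto simp: add_edge_def)
    then have "card ((E' - ?E1) \<inter> W \<times> W) < card ((E' - E) \<inter> W \<times> W)"
      by (intro psubset_card_mono) auto
    moreover have "conn ?E1 W"
      using less.prems(3) by (rule conn_mono) (auto simp: add_edge_def)
    ultimately have "hpoly E' W - hpoly ?E1 W \<in> gamma_cone (card W - 1)"
      using less.hyps[of ?E1] E1 sym_add_edge[OF less.prems(1)] by blast
    moreover have "hpoly ?E1 W - hpoly E W \<in> gamma_cone (card W - 1)"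
      using pos less.prems(1) \<open>irrefl E\<close> less.prems(3) \<open>u \<noteq> v\<close> by (rule hpoly_add_edge_gamma)
    ultimately show ?thesis
      using gamma_cone_add by fastforce
  qed
qed

text \<open>
  The $H$-polynomials of paths, indexed by the number of vertices: the leaf formula for an end
  vertex of the path, whose connected sets $S$ are the initial segments of the rest.
\<close>

function path_h :: "nat \<Rightarrow> int poly poly" where
  "path_h 0 = 1"
| "path_h (Suc 0) = 1"
| "path_h (Suc (Suc n)) = (alpha_var + t_var) * path_h (Suc n) +
     alpha_var * t_var * (\<Sum>k\<in>{1..n}. path_h k * path_h (Suc n - k))"
  by pat_completeness auto
termination by (relation "Wellfounded.measure id") auto

lemma path_h_gamma: "path_h m \<in> gamma_cone (m - 1)"
proof (induction m rule: path_h.induct)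
  case (3 n)
  have "path_h k * path_h (Suc n - k) \<in> gamma_cone (n - 1)" if "k \<in> {1..n}" for k
  proof -
    have "k - 1 + (Suc n - k - 1) = n - 1" using that by auto
    then show ?thesis
      using gamma_cone_mult[OF 3(2)[OF that] 3(3)[OF that]] by simp
  qed
  then have s: "(\<Sum>k\<in>{1..n}. path_h k * path_h (Suc n - k)) \<in> gamma_cone (n - 1)"
    by (rule gamma_cone_sum)
  have "alpha_var * t_var * (\<Sum>k\<in>{1..n}. path_h k * path_h (Suc n - k)) \<in> gamma_cone (Suc n)"
  proof (cases n)
    case (Suc m)
    then show ?thesis
      using gamma_cone_times_alpha_t[OF s] by simp
  qed simp
  then show ?case
    using gamma_cone_add[OF gamma_cone_times_alpha_plus_t[OF 3(1)]] by simp
qed (simp_all add: gamma_cone_1)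

lemma gamma_cone_mult_diff:
  assumes "p - p' \<in> gamma_cone n" "q - q' \<in> gamma_cone m" "p' \<in> gamma_cone n" "q' \<in> gamma_cone m"
  shows "p * q - p' * q' \<in> gamma_cone (n + m)"
proof -
  have q: "q \<in> gamma_cone m"
    using gamma_cone_add[OF assms(2,4)] by simp
  have "p * q - p' * q' = (p - p') * q + p' * (q - q')"
    by (simp add: algebra_simps)
  then show ?thesis
    using gamma_cone_add[OF gamma_cone_mult[OF assms(1) q] gamma_cone_mult[OF assms(3,2)]] by simp
qed

text \<open>
  With all edges at a non-cut vertex $v$ removed except one, the leaf formula has a summand for every connected
  set $S$, and there is one of each size $k$. The chosen summands dominate those of the
  recursion for paths by induction, and the remaining ones lie in the cone.
\<close>

theorem hpoly_ge_path:
  fixes W :: "'v::finite set"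
  assumes "sym E" "irrefl E" "conn E W"
  shows "hpoly E W - path_h (card W) \<in> gamma_cone (card W - 1)"
  using assms
proof (induction "card W" arbitrary: W E rule: less_induct)
  case less
  note E = less.prems
  have IH: "hpoly D S - path_h (card S) \<in> gamma_cone (card S - 1)"
    if "sym D" "irrefl D" "conn D S" "card S < card W" for D :: "'v rel" and S
    using less.hyps that by blast
  have pos: "hpoly D S \<in> gamma_cone (card S - 1)"
    if "sym D" "irrefl D" "conn D S" "card S < card W" for D :: "'v rel" and S
    using gamma_cone_add[OF IH[OF that] path_h_gamma] by simp
  have "card W > 0"
    using E(3) conn_nonempty by (auto simp: card_gt_0_iff)
  then consider "card W = 1" | "card W \<ge> 2" by linarith
  then show ?case
  proof cases
    case 1
    then obtain v where "W = {v}"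
      by (auto simp: card_1_singleton_iff)
    then show ?thesis
      by (simp add: hpoly_singleton)
  next
    case 2
    obtain u v U where U: "W = insert v U" "v \<notin> U" "u \<in> U" "conn E U" "(u, v) \<in> E"
      using E(1,3) 2 by (rule conn_non_cut_vertex)
    \<comment> \<open>In E1 the vertex v is a leaf attached to u.\<close>
    define E0 where "E0 = E - ({v} \<times> UNIV \<union> UNIV \<times> {v})"
    define E1 where "E1 = add_edge E0 v u"
    have symE0: "sym E0"
      using E(1) by (auto simp: E0_def sym_def)
    have irreflE0: "irrefl E0"
      using E(2) by (auto simp: E0_def irrefl_def)
    have "E \<inter> U \<times> U = E0 \<inter> U \<times> U"
      using U(2) by (auto simp: E0_def)
    then have connU: "conn E0 U"
      using U(4) conn_cong by metis
    have "u \<noteq> v" using U by auto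
    have E1: "sym E1" "irrefl E1" "E1 \<subseteq> E"
      using symE0 irreflE0 \<open>u \<noteq> v\<close> U(5) E(1)
      by (auto simp: E1_def intro: sym_add_edge irrefl_add_edge) (auto simp: add_edge_def E0_def dest: symD)
    have connE1: "conn E1 W"
      unfolding U(1)
    proof (rule conn_insert)
      show "conn E1 U"
        using connU by (rule conn_mono) (auto simp: E1_def add_edge_def)
    qed (use U E1 in \<open>auto simp: E1_def add_edge_def\<close>)
    have step1: "hpoly E W - hpoly E1 W \<in> gamma_cone (card W - 1)"
      using pos E(1,2) E1(1,3) connE1 by (rule hpoly_mono_gamma)
    obtain n where n: "card W = Suc (Suc n)"
      using 2 by (metis add_2_eq_Suc le_Suc_ex)
    have cardU: "card U = Suc n"
      using n U(1,2) by simp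
    define \<S> where "\<S> = {S. conn E0 S \<and> u \<in> S \<and> S \<subset> U}"
    define g where "g S = hpoly E0 S * hpoly (contract E1 (insert v S)) (U - S)" for S
    have leaf: "hpoly E1 W = (alpha_var + t_var) * hpoly E0 U + alpha_var * t_var * (\<Sum>S\<in>\<S>. g S)"
      unfolding E1_def U(1) \<S>_def g_def
      using symE0 connU U(3,2) by (rule hpoly_add_leaf) (auto simp: E0_def)
    have S: "0 < card S" "card S \<le> n" "card (U - S) = Suc n - card S" "sym (contract E1 (insert v S))"
      "irrefl (contract E1 (insert v S))" "conn (contract E1 (insert v S)) (U - S)" if "S \<in> \<S>" for S
    proof -
      have s: "S \<subset> U" "u \<in> S" using that by (auto simp: \<S>_def)
      show "0 < card S" using s by (auto simp: card_gt_0_iff)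
      have "card S < card U" using s by (intro psubset_card_mono) auto
      then show "card S \<le> n" using cardU by simp
      show "card (U - S) = Suc n - card S" using s cardU by (subst card_Diff_subset) auto
      show "sym (contract E1 (insert v S))" "irrefl (contract E1 (insert v S))"
        using E1 by (auto intro: sym_contract irrefl_contract)
      have "W - insert v S = U - S" using U by auto
      moreover have "conn (contract E1 (insert v S)) (W - insert v S)"
        using connE1 E1(1) by (rule conn_contract) (use s U in auto)
      ultimately show "conn (contract E1 (insert v S)) (U - S)" by simp
    qed
    have g_ge: "g S - path_h (card S) * path_h (Suc n - card S) \<in> gamma_cone (n - 1)"
      if "S \<in> \<S>" for S
    proof -
      have "hpoly E0 S - path_h (card S) \<in> gamma_cone (card S - 1)"
        using that S[OF that] n symE0 irreflE0 by (intro IH) (auto simp: \<S>_def)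
      moreover have "hpoly (contract E1 (insert v S)) (U - S) - path_h (Suc n - card S)
          \<in> gamma_cone (Suc n - card S - 1)"
        using IH[OF S(4-6)[OF that]] S(1-3)[OF that] n by simp
      moreover have "card S - 1 + (Suc n - card S - 1) = n - 1"
        using S(1,2)[OF that] by linarith
      ultimately show ?thesis
        using gamma_cone_mult_diff[OF _ _ path_h_gamma path_h_gamma] unfolding g_def by metis
    qed
    have g_pos: "g S \<in> gamma_cone (n - 1)" if "S \<in> \<S>" for S
    proof -
      have "card S - 1 + (Suc n - card S - 1) = n - 1"
        using S(1,2)[OF that] by linarith
      then have "path_h (card S) * path_h (Suc n - card S) \<in> gamma_cone (n - 1)"
        using gamma_cone_mult[OF path_h_gamma path_h_gamma] by metis
      then show ?thesis
        using gamma_cone_add[OF g_ge[OF that]] by fastforce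
    qed
    have "\<exists>S. S \<in> \<S> \<and> card S = k" if k: "k \<in> {1..n}" for k
    proof -
      obtain S where "conn E0 S" "u \<in> S" "S \<subseteq> U" "card S = k"
        using conn_subset_of_card[OF symE0 connU U(3), of k] k cardU by auto
      then show ?thesis
        using k cardU by (intro exI[of _ S]) (auto simp: \<S>_def)
    qed
    then obtain C where C: "\<And>k. k \<in> {1..n} \<Longrightarrow> C k \<in> \<S> \<and> card (C k) = k"
      by metis
    have injC: "inj_on C {1..n}"
      using C by (metis inj_onI)
    have "(\<Sum>S\<in>\<S>. g S) = (\<Sum>S\<in>\<S> - C ` {1..n}. g S) + (\<Sum>S\<in>C ` {1..n}. g S)"
      using C by (intro sum.subset_diff) auto
    also have "(\<Sum>S\<in>C ` {1..n}. g S) = (\<Sum>k\<in>{1..n}. g (C k))"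
      using injC by (simp add: sum.reindex)
    finally have "(\<Sum>S\<in>\<S>. g S) - (\<Sum>k\<in>{1..n}. path_h k * path_h (Suc n - k)) =
        (\<Sum>S\<in>\<S> - C ` {1..n}. g S) + (\<Sum>k\<in>{1..n}. g (C k) - path_h k * path_h (Suc n - k))"
      by (simp add: sum_subtractf)
    also have "\<dots> \<in> gamma_cone (n - 1)"
    proof (intro gamma_cone_add gamma_cone_sum)
      show "g S \<in> gamma_cone (n - 1)" if "S \<in> \<S> - C ` {1..n}" for S
        using that g_pos by blast
      show "g (C k) - path_h k * path_h (Suc n - k) \<in> gamma_cone (n - 1)" if "k \<in> {1..n}" for k
        using g_ge[of "C k"] C[OF that] by simp
    qed
    finally have diff: "(\<Sum>S\<in>\<S>. g S) - (\<Sum>k\<in>{1..n}. path_h k * path_h (Suc n - k)) \<in> gamma_cone (n - 1)" .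
    have "alpha_var * t_var * ((\<Sum>S\<in>\<S>. g S) - (\<Sum>k\<in>{1..n}. path_h k * path_h (Suc n - k)))
        \<in> gamma_cone (Suc n)"
    proof (cases "n = 0")
      case True
      then have "\<S> = {}" using S(1,2) by fastforce
      then show ?thesis using True by simp
    next
      case False
      then show ?thesis
        using gamma_cone_times_alpha_t[OF diff] by simp
    qed
    moreover have "(alpha_var + t_var) * (hpoly E0 U - path_h (Suc n)) \<in> gamma_cone (Suc n)"
      using IH[OF symE0 irreflE0 connU] cardU n by (intro gamma_cone_times_alpha_plus_t) simp
    ultimately have "(alpha_var + t_var) * (hpoly E0 U - path_h (Suc n)) +
        alpha_var * t_var * ((\<Sum>S\<in>\<S>. g S) - (\<Sum>k\<in>{1..n}. path_h k * path_h (Suc n - k)))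
        \<in> gamma_cone (Suc n)"
      by (intro gamma_cone_add)
    also have "(alpha_var + t_var) * (hpoly E0 U - path_h (Suc n)) +
        alpha_var * t_var * ((\<Sum>S\<in>\<S>. g S) - (\<Sum>k\<in>{1..n}. path_h k * path_h (Suc n - k))) =
        hpoly E1 W - path_h (card W)"
      unfolding leaf n path_h.simps(3) by (simp only: algebra_simps)
    finally have "hpoly E1 W - path_h (card W) \<in> gamma_cone (card W - 1)"
      by (simp add: n)
    then show ?thesis
      using gamma_cone_add[OF step1] by fastforce
  qed
qed

corollary hpoly_gamma:
  fixes W :: "'v::finite set"
  assumes "sym E" "irrefl E" "conn E W"
  shows "hpoly E W \<in> gamma_cone (card W - 1)"
  using gamma_cone_add[OF hpoly_ge_path[OF assms] path_h_gamma] by simp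

corollary hpoly_mono:
  fixes W :: "'v::finite set"
  assumes "sym E" "sym E'" "irrefl E'" "E \<subseteq> E'" "conn E W"
  shows "hpoly E' W - hpoly E W \<in> gamma_cone (card W - 1)"
  using hpoly_gamma assms(2,3,1,4,5) by (rule hpoly_mono_gamma)

section \<open>Path graphs\<close>

text \<open>
  Adjacency in the path on $U$ is taken relative to $U$. Thus convex parts of a path are paths, and so is
  what remains after contracting an initial segment.
\<close>

definition consecutive :: "'v::linorder set \<Rightarrow> 'v \<Rightarrow> 'v \<Rightarrow> bool" where
  "consecutive U x y \<longleftrightarrow> x < y \<and> U \<inter> {x<..<y} = {} \<or> y < x \<and> U \<inter> {y<..<x} = {}"

definition is_path :: "'v::linorder rel \<Rightarrow> 'v set \<Rightarrow> bool" where
  "is_path E U \<longleftrightarrow> (\<forall>x\<in>U. \<forall>y\<in>U. (x, y) \<in> E \<longleftrightarrow> consecutive U x y)"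

lemma is_path_convex:
  assumes "is_path E U" "S \<subseteq> U" "\<And>x y z. x \<in> S \<Longrightarrow> y \<in> S \<Longrightarrow> z \<in> U \<Longrightarrow> x < z \<Longrightarrow> z < y \<Longrightarrow> z \<in> S"
  shows "is_path E S"
proof -
  have "S \<inter> {x<..<y} = U \<inter> {x<..<y}" if "x \<in> S" "y \<in> S" for x y
    using assms(2) assms(3)[OF that] by auto
  then have "consecutive S x y \<longleftrightarrow> consecutive U x y" if "x \<in> S" "y \<in> S" for x y
    using that by (simp only: consecutive_def)
  moreover have "(x, y) \<in> E \<longleftrightarrow> consecutive U x y" if "x \<in> S" "y \<in> S" for x y
    using assms(1,2) that unfolding is_path_def by blast
  ultimately show ?thesis
    by (simp add: is_path_def)
qed

lemma is_path_cong:
  assumes "E \<inter> U \<times> U = E' \<inter> U \<times> U"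
  shows "is_path E U \<longleftrightarrow> is_path E' U"
proof -
  have "(x, y) \<in> E \<longleftrightarrow> (x, y) \<in> E'" if "x \<in> U" "y \<in> U" for x y
    using assms that by blast
  then show ?thesis
    by (simp add: is_path_def)
qed

text \<open>
  If $S$ skipped $y$, then an edge within $S$ would have to jump over $y$.
\<close>

lemma conn_path_initial:
  assumes "is_path E U" "conn E S" "S \<subseteq> U" "u \<in> S" "\<And>x. x \<in> U \<Longrightarrow> u \<le> x"
    "x \<in> S" "y \<in> U" "y < x"
  shows "y \<in> S"
proof (rule ccontr)
  assume y: "y \<notin> S"
  define A where "A = {z \<in> S. z < y}"
  have "u \<noteq> y"
    using assms(4) y by blast
  then have "u \<in> A"
    using assms(4) assms(5)[OF assms(7)] by (simp add: A_def)
  moreover have "x \<notin> A"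
    using less_not_sym[OF assms(8)] by (simp add: A_def)
  moreover have "A \<subseteq> S"
    by (auto simp: A_def)
  ultimately have "A \<subseteq> S" "A \<noteq> {}" "A \<noteq> S"
    using assms(6) by blast+
  with assms(2) obtain a b where ab: "a \<in> A" "b \<in> S - A" "(a, b) \<in> E"
    by (rule connE)
  have "a < y"
    using ab(1) by (simp add: A_def)
  moreover have "y < b"
  proof -
    have "b \<in> S" "\<not> b < y" "b \<noteq> y"
      using ab(2) y by (auto simp: A_def)
    then show ?thesis by simp
  qed
  moreover have "a \<in> U" "b \<in> U"
    using ab \<open>A \<subseteq> S\<close> assms(3) by blast+
  then have "consecutive U a b"
    using assms(1) ab(3) by (simp add: is_path_def)
  ultimately show False
    using assms(7) by (auto simp: consecutive_def)
qed

text \<open>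
  For the least vertex $v$ of a path, the leaf formula turns into the defining recursion of
  \<open>path_h\<close>: the connected sets containing the second vertex are initial segments, so each size occurs
  once, and contracting one of them creates no new edge among the larger vertices.
\<close>

theorem hpoly_path:
  fixes U :: "'v::{finite,linorder} set"
  assumes "sym E" "is_path E U" "U \<noteq> {}"
  shows "conn E U \<and> hpoly E U = path_h (card U)"
  using assms
proof (induction "card U" arbitrary: U E rule: less_induct)
  case less
  note E = less.prems
  define v where "v = Min U"
  have v: "v \<in> U" "\<And>x. x \<in> U \<Longrightarrow> v \<le> x"
    using E(3) by (simp_all add: v_def)
  show ?case
  proof (cases "U = {v}")
    case True
    then show ?thesis
      by (metis One_nat_def card_1_singleton_iff conn_singleton hpoly_singleton path_h.simps(2))
  next
    case False
    define U' where "U' = U - {v}"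
    have U': "U' \<noteq> {}" "v \<notin> U'" "U = insert v U'"
      using False v by (auto simp: U'_def)
    define u where "u = Min U'"
    have u: "u \<in> U'" "\<And>x. x \<in> U' \<Longrightarrow> u \<le> x"
      using U'(1) by (simp_all add: u_def)
    have vless: "v < x" if "x \<in> U'" for x
      using v(2)[of x] that U' by (auto simp: order.strict_iff_order)
    obtain n where n: "card U' = Suc n"
      using U'(1) by (metis card_gt_0_iff finite_code gr0_implies_Suc)
    have cardU: "card U = Suc (Suc n)"
      using n U' by simp
    have path': "is_path E U'"
      using E(2) by (rule is_path_convex) (use U' vless in fastforce)+
    have IH': "conn E U'" "hpoly E U' = path_h (Suc n)"
      using less.hyps[OF _ E(1) path' U'(1)] cardU n by simp_all
    have nbr: "(v, w) \<in> E \<longleftrightarrow> w = u" if "w \<in> U'" for w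
    proof -
      have "(v, w) \<in> E \<longleftrightarrow> consecutive U v w"
        using E(2) that U' by (auto simp: is_path_def)
      also have "\<dots> \<longleftrightarrow> U \<inter> {v<..<w} = {}"
        using vless[OF that] by (auto simp: consecutive_def)
      also have "\<dots> \<longleftrightarrow> w = u"
      proof
        assume "U \<inter> {v<..<w} = {}"
        then have "\<not> u < w"
          using u(1) vless[OF u(1)] U'(3) by auto
        then show "w = u"
          using u(2)[OF that] by simp
      next
        assume "w = u"
        then show "U \<inter> {v<..<w} = {}"
          using u(2) U'(3) by fastforce
      qed
      finally show ?thesis .
    qed
    have conn: "conn E U"
      unfolding U'(3) using IH'(1) u(1) _ E(1)
      by (rule conn_insert) (use nbr[OF u(1)] E(1) in \<open>auto dest: symD\<close>)
    define E0 where "E0 = E - ({v} \<times> UNIV \<union> UNIV \<times> {v})"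
    define E1 where "E1 = add_edge E0 v u"
    have symE0: "sym E0"
      using E(1) by (auto simp: E0_def sym_def)
    have symE1: "sym E1"
      using symE0 by (simp add: E1_def sym_add_edge)
    have eq0: "E \<inter> U' \<times> U' = E0 \<inter> U' \<times> U'"
      using U'(2) by (auto simp: E0_def)
    have path0: "is_path E0 U'"
      using path' is_path_cong[OF eq0] by simp
    have conn0: "conn E0 U'"
      using IH'(1) conn_cong[OF eq0] by simp
    have h0: "hpoly E0 U' = path_h (Suc n)"
      using IH'(2) hpoly_cong[OF eq0] by simp
    have "(v, v) \<notin> E"
      using E(2) v(1) by (auto simp: is_path_def consecutive_def)
    then have eq1: "E \<inter> U \<times> U = E1 \<inter> U \<times> U"
      using nbr u(1) E(1) unfolding U'(3) E1_def E0_def add_edge_def by (auto dest: symD)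
    define \<S> where "\<S> = {S. conn E0 S \<and> u \<in> S \<and> S \<subset> U'}"
    have initial: "y \<in> S" if "S \<in> \<S>" "x \<in> S" "y \<in> U'" "y < x" for S x y
      using that by (intro conn_path_initial[OF path0, of S u x y] u(2)) (auto simp: \<S>_def)
    have card\<S>: "card S \<in> {1..n}" if "S \<in> \<S>" for S
    proof -
      have "card S < card U'"
        using that by (intro psubset_card_mono) (auto simp: \<S>_def)
      moreover have "card S > 0"
        using that by (auto simp: \<S>_def card_gt_0_iff)
      ultimately show ?thesis using n by auto
    qed
    have bij: "bij_betw card \<S> {1..n}"
    proof (rule bij_betw_imageI)
      show "inj_on card \<S>"
      proof (rule inj_onI)
        fix S T assume ST: "S \<in> \<S>" "T \<in> \<S>" "card S = card T"
        have "S \<subseteq> T \<or> T \<subseteq> S"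
        proof (rule ccontr)
          assume "\<not> (S \<subseteq> T \<or> T \<subseteq> S)"
          then obtain x y where xy: "x \<in> S" "x \<notin> T" "y \<in> T" "y \<notin> S" by blast
          moreover have "x \<in> U'" "y \<in> U'"
            using xy ST by (auto simp: \<S>_def)
          ultimately show False
            using initial[OF ST(1), of x y] initial[OF ST(2), of y x] by (cases x y rule: linorder_cases) auto
        qed
        then show "S = T"
          using ST(3) card_subset_eq[of T S] card_subset_eq[of S T] by auto
      qed
      have "k \<in> card ` \<S>" if k: "k \<in> {1..n}" for k
      proof -
        obtain S where "conn E0 S" "u \<in> S" "S \<subseteq> U'" "card S = k"
          using conn_subset_of_card[OF symE0 conn0 u(1), of k] k n by auto
        then have "S \<in> \<S>"
          using k n by (auto simp: \<S>_def)
        then show ?thesis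
          using \<open>card S = k\<close> by blast
      qed
      then show "card ` \<S> = {1..n}"
        using card\<S> by blast
    qed
    have prods: "hpoly E0 S * hpoly (contract E1 (insert v S)) (U' - S) =
        path_h (card S) * path_h (Suc n - card S)" if S: "S \<in> \<S>" for S
    proof -
      let ?C = "contract E1 (insert v S)"
      have s: "S \<subset> U'" "u \<in> S" using S by (auto simp: \<S>_def)
      have cardS: "card S \<in> {1..n}" using card\<S>[OF S] .
      have cardD: "card (U' - S) = Suc n - card S"
        using s n by (subst card_Diff_subset) auto
      have "is_path E0 S"
        using path0 by (rule is_path_convex) (use s initial[OF S] in auto)
      then have 1: "hpoly E0 S = path_h (card S)"
        using less.hyps[OF _ symE0, of S] cardS cardU s(2) by auto
      have above: "x < y" if "x \<in> insert v S" "y \<in> U' - S" for x y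
      proof -
        have "\<not> y \<le> x" if "x \<in> S"
          using initial[OF S, of x y] that \<open>y \<in> U' - S\<close> by (metis DiffE order.order_iff_strict)
        then show ?thesis
          using that vless by auto
      qed
      have pathD: "is_path E0 (U' - S)"
        using path0 by (rule is_path_convex) (use initial[OF S] in auto)
      have "?C \<inter> (U' - S) \<times> (U' - S) = E0 \<inter> (U' - S) \<times> (U' - S)"
      proof -
        \<comment> \<open>Only the least remaining vertex can have a neighbour in the removed segment.\<close>
        have min: "y \<le> z" if "(y, s) \<in> E1" "s \<in> insert v S" "y \<in> U' - S" "z \<in> U' - S" for y z s
        proof -
          have "s < y" "s < z" using above that by auto
          have "(y, s) \<in> E"
            using that eq1 s U'(3) by blast
          then have "consecutive U y s"
            using E(2) that s U'(3) unfolding is_path_def by blast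
          then have "U \<inter> {s<..<y} = {}"
            using \<open>s < y\<close> by (auto simp: consecutive_def)
          then show ?thesis
            using \<open>s < z\<close> that U'(3) by (metis DiffD1 disjoint_iff greaterThanLessThan_iff insertI2 not_le)
        qed
        have "(y, z) \<in> ?C \<longleftrightarrow> (y, z) \<in> E0" if yz: "y \<in> U' - S" "z \<in> U' - S" for y z
        proof
          assume "(y, z) \<in> ?C"
          then consider "(y, z) \<in> E1" | s s' where "y \<noteq> z" "s \<in> insert v S" "(y, s) \<in> E1" "s' \<in> insert v S" "(z, s') \<in> E1"
            unfolding contract_def by blast
          then show "(y, z) \<in> E0"
          proof cases
            case 1
            then show ?thesis
              using yz s U' by (auto simp: E1_def add_edge_def)
          next
            case 2
            then show ?thesis
              using min[OF 2(3,2) yz] min[OF 2(5,4) yz(2,1)] by simp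
          qed
        qed (auto simp: contract_def E1_def add_edge_def)
        then show ?thesis by auto
      qed
      then have "is_path ?C (U' - S)"
        using pathD is_path_cong by metis
      then have 2: "hpoly ?C (U' - S) = path_h (Suc n - card S)"
        using less.hyps[OF _ sym_contract[OF symE1], of "U' - S" "insert v S"] cardD cardS cardU s by auto
      show ?thesis
        using 1 2 by simp
    qed
    have "(\<Sum>S\<in>\<S>. hpoly E0 S * hpoly (contract E1 (insert v S)) (U' - S)) =
        (\<Sum>S\<in>\<S>. path_h (card S) * path_h (Suc n - card S))"
      by (rule sum.cong[OF refl]) (rule prods)
    also have "\<dots> = (\<Sum>k\<in>{1..n}. path_h k * path_h (Suc n - k))"
      by (rule sum.reindex_bij_betw[OF bij])
    finally have sums: "(\<Sum>S\<in>\<S>. hpoly E0 S * hpoly (contract E1 (insert v S)) (U' - S)) =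
        (\<Sum>k\<in>{1..n}. path_h k * path_h (Suc n - k))" .
    have "hpoly E1 U = (alpha_var + t_var) * hpoly E0 U' + alpha_var * t_var *
        (\<Sum>S\<in>\<S>. hpoly E0 S * hpoly (contract E1 (insert v S)) (U' - S))"
      unfolding E1_def U'(3) \<S>_def
      using symE0 conn0 u(1) U'(2) by (rule hpoly_add_leaf) (auto simp: E0_def)
    also have "\<dots> = path_h (card U)"
      unfolding sums h0 cardU path_h.simps(3) ..
    finally show ?thesis
      using conn hpoly_cong[OF eq1] by simp
  qed
qed

section \<open>The building set of a graph\<close>

text \<open>
  The set of vertices reachable from $u$ is a part that no edge leaves.
\<close>

lemma connected_induce_iff_conn:
  assumes "sym (parcs G)"
  shows "Digraph_Component.connected (with_proj G \<restriction> S) \<longleftrightarrow> conn (parcs G) S"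
proof -
  define R where "R = (arcs_ends (with_proj G \<restriction> S))\<^sup>s"
  have "arcs_ends (with_proj G \<restriction> S) = {(u, v). (u, v) \<in> parcs G \<and> u \<in> S \<and> v \<in> S}"
    by (auto simp: arcs_ends_conv image_iff)
  moreover have "(u, v) \<in> parcs G \<longleftrightarrow> (v, u) \<in> parcs G" for u v
    using assms by (meson symD)
  ultimately have R: "(u, v) \<in> R \<longleftrightarrow> (u, v) \<in> parcs G \<and> u \<in> S \<and> v \<in> S" for u v
    unfolding R_def symcl_def by auto
  have conv: "Digraph_Component.connected (with_proj G \<restriction> S) \<longleftrightarrow>
      S \<noteq> {} \<and> (\<forall>u\<in>S. \<forall>v\<in>S. (u, v) \<in> rtrancl_on S R)"
    unfolding R_def connected_conv induce_subgraph_verts ..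
  have "conn (parcs G) S" if ne: "S \<noteq> {}" and reach: "\<And>u v. u \<in> S \<Longrightarrow> v \<in> S \<Longrightarrow> (u, v) \<in> rtrancl_on S R"
    unfolding conn_def
  proof (intro conjI allI impI)
    fix A assume A: "A \<subseteq> S" "A \<noteq> {}" "A \<noteq> S"
    then obtain a b where ab: "a \<in> A" "b \<in> S" "b \<notin> A" by blast
    then have "(a, b) \<in> rtrancl_on S R"
      using A(1) by (intro reach) blast+
    then have "b \<in> A \<or> (\<exists>a\<in>A. \<exists>b\<in>S - A. (a, b) \<in> parcs G)"
    proof (induction rule: rtrancl_on_induct)
      case base
      then show ?case using ab(1) by simp
    next
      case (step y z)
      have "(y, z) \<in> parcs G" "z \<in> S"
        using step R by simp_all
      then show ?case
        using step.IH by (cases "z \<in> A") blast+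
    qed
    then show "\<exists>a\<in>A. \<exists>b\<in>S - A. (a, b) \<in> parcs G"
      using ab(3) by simp
  qed (rule ne)
  moreover have "(u, v) \<in> rtrancl_on S R" if c: "conn (parcs G) S" and uv: "u \<in> S" "v \<in> S" for u v
  proof (rule ccontr)
    assume not: "(u, v) \<notin> rtrancl_on S R"
    define A where "A = {w. (u, w) \<in> rtrancl_on S R}"
    have "A \<subseteq> S"
      unfolding A_def by (auto dest: in_rtrancl_on_in_F)
    moreover have "u \<in> A"
      unfolding A_def using uv(1) by simp
    then have "A \<noteq> {}" by blast
    moreover have "A \<noteq> S"
      using not uv(2) by (auto simp: A_def)
    ultimately obtain a b where ab: "a \<in> A" "b \<in> S - A" "(a, b) \<in> parcs G"
      using c by (metis connE)
    then have "(a, b) \<in> R"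
      using R \<open>A \<subseteq> S\<close> by blast
    then have "b \<in> A"
      using ab rtrancl_on_into_rtrancl_on[of u a S R b] by (simp add: A_def)
    then show False using ab(2) by simp
  qed
  ultimately show ?thesis
    unfolding conv using conn_nonempty by blast
qed

section \<open>Faces of graph-associahedra\<close>

text \<open>
  The simplex over this set is the face of $\Delta^S$ on which the functional $c$ is maximal, and
  \<open>height\<close> is the maximum.
\<close>

definition peak :: "(real, 'v::finite) vec \<Rightarrow> 'v set \<Rightarrow> 'v set" where
  "peak c S = {i \<in> S. \<forall>j\<in>S. c $ j \<le> c $ i}"

definition height :: "(real, 'v::finite) vec \<Rightarrow> 'v set \<Rightarrow> real" where
  "height c S = Max (($) c ` S)"

definition barycenter :: "'v::finite set \<Rightarrow> (real, 'v) vec" where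
  "barycenter S = (\<chi> i. if i \<in> S then 1 / real (card S) else 0)"

lemma mem_face_simplex:
  fixes S :: "'v::finite set"
  shows "x \<in> face_simplex S \<longleftrightarrow> (\<forall>i. 0 \<le> x $ i) \<and> (\<forall>i. i \<notin> S \<longrightarrow> x $ i = 0) \<and> (\<Sum>i\<in>S. x $ i) = 1"
proof -
  have inj: "inj_on (\<lambda>i::'v. axis i (1::real)) S"
    by (rule inj_onI) (simp add: axis_eq_axis)
  have comp: "(\<Sum>i\<in>S. a i *\<^sub>R axis i (1::real)) $ k = (if k \<in> S then a k else 0)" for a :: "'v \<Rightarrow> real" and k
  proof -
    have "(\<Sum>i\<in>S. a i *\<^sub>R axis i (1::real)) $ k = (\<Sum>i\<in>S. a i * (if k = i then 1 else 0))"
      by (simp add: axis_def)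
    also have "\<dots> = (\<Sum>i\<in>S. if i = k then a i else 0)"
      by (rule sum.cong) auto
    finally show ?thesis by simp
  qed
  show ?thesis
  proof
    assume "x \<in> face_simplex S"
    then obtain u where u: "\<forall>y\<in>(\<lambda>i. axis i 1) ` S. 0 \<le> u y" "sum u ((\<lambda>i. axis i 1) ` S) = 1"
      "(\<Sum>y\<in>(\<lambda>i. axis i 1) ` S. u y *\<^sub>R y) = x"
      unfolding face_simplex_def by (subst (asm) convex_hull_finite) auto
    have "x = (\<Sum>i\<in>S. u (axis i 1) *\<^sub>R axis i 1)"
      using u(3) by (simp add: sum.reindex[OF inj])
    then have xk: "x $ k = (if k \<in> S then u (axis k 1) else 0)" for k
      by (simp only: comp)
    have "(\<Sum>i\<in>S. x $ i) = sum u ((\<lambda>i. axis i 1) ` S)"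
      by (simp add: sum.reindex[OF inj] xk)
    then show "(\<forall>i. 0 \<le> x $ i) \<and> (\<forall>i. i \<notin> S \<longrightarrow> x $ i = 0) \<and> (\<Sum>i\<in>S. x $ i) = 1"
      using u(1,2) by (simp add: xk)
  next
    assume x: "(\<forall>i. 0 \<le> x $ i) \<and> (\<forall>i. i \<notin> S \<longrightarrow> x $ i = 0) \<and> (\<Sum>i\<in>S. x $ i) = 1"
    have "x = (\<Sum>i\<in>S. (x $ i) *\<^sub>R axis i 1)"
      unfolding vec_eq_iff comp using x by auto
    moreover have "(\<Sum>i\<in>S. (x $ i) *\<^sub>R axis i 1) \<in> face_simplex S"
      unfolding face_simplex_def
      by (rule convex_sum) (use x in \<open>auto intro: hull_inc\<close>)
    ultimately show "x \<in> face_simplex S"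
      by simp
  qed
qed

lemma barycenter_mem: "S \<noteq> {} \<Longrightarrow> S \<subseteq> T \<Longrightarrow> barycenter S \<in> face_simplex T"
  by (auto simp: mem_face_simplex barycenter_def sum.If_cases Int_absorb1 card_gt_0_iff)

lemma barycenter_mem_iff:
  fixes S T :: "'v::finite set"
  assumes "S \<noteq> {}"
  shows "barycenter S \<in> face_simplex T \<longleftrightarrow> S \<subseteq> T"
proof
  assume b: "barycenter S \<in> face_simplex T"
  show "S \<subseteq> T"
  proof
    fix i assume "i \<in> S"
    then have "barycenter S $ i \<noteq> 0"
      by (auto simp: barycenter_def)
    then show "i \<in> T"
      using b by (auto simp: mem_face_simplex)
  qed
qed (use assms barycenter_mem in blast)

lemma axis_mem_face_simplex: "i \<in> S \<Longrightarrow> axis i 1 \<in> face_simplex S"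
  unfolding face_simplex_def by (auto intro: hull_inc)

lemma height_ge: "i \<in> S \<Longrightarrow> c $ i \<le> height c S"
  by (simp add: height_def)

lemma height_attained:
  assumes "S \<noteq> {}"
  obtains k where "k \<in> S" "c $ k = height c S"
proof -
  have "height c S \<in> ($) c ` S"
    unfolding height_def using assms by (intro Max_in) auto
  then show thesis
    using that by auto
qed

lemma mem_peak_iff: "i \<in> peak c S \<longleftrightarrow> i \<in> S \<and> c $ i = height c S"
proof
  assume i: "i \<in> peak c S"
  then have "i \<in> S" by (simp add: peak_def)
  then obtain k where "k \<in> S" "c $ k = height c S"
    using height_attained[of S c] by blast
  then have "height c S \<le> c $ i"
    using i by (auto simp: peak_def)
  then show "i \<in> S \<and> c $ i = height c S"
    using \<open>i \<in> S\<close> height_ge[of i S c] by simp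
next
  assume "i \<in> S \<and> c $ i = height c S"
  then show "i \<in> peak c S"
    by (simp add: peak_def height_ge)
qed

lemma peak_nonempty: "S \<noteq> {} \<Longrightarrow> peak c S \<noteq> {}"
  by (metis empty_iff height_attained mem_peak_iff)

text \<open>
  The deficit of $c$ below its maximum is a sum of nonnegative terms, so it vanishes only if each term does.
\<close>

lemma inner_face_simplex:
  fixes S :: "'v::finite set"
  assumes "x \<in> face_simplex S"
  shows "height c S - c \<bullet> x = (\<Sum>i\<in>S. (height c S - c $ i) * x $ i)"
proof -
  have "c \<bullet> x = (\<Sum>i\<in>UNIV. c $ i * x $ i)"
    by (simp add: inner_vec_def)
  also have "\<dots> = (\<Sum>i\<in>S. c $ i * x $ i)"
    by (rule sum.mono_neutral_right) (use assms in \<open>auto simp: mem_face_simplex\<close>)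
  finally have "height c S - c \<bullet> x = height c S * (\<Sum>i\<in>S. x $ i) - (\<Sum>i\<in>S. c $ i * x $ i)"
    using assms by (simp add: mem_face_simplex)
  then show ?thesis
    by (simp add: sum_distrib_left sum_subtractf left_diff_distrib)
qed

lemma inner_face_simplex_le:
  assumes "x \<in> face_simplex S"
  shows "c \<bullet> x \<le> height c S"
proof -
  have "0 \<le> (\<Sum>i\<in>S. (height c S - c $ i) * x $ i)"
    using assms height_ge by (intro sum_nonneg mult_nonneg_nonneg) (auto simp: mem_face_simplex)
  then show ?thesis
    using inner_face_simplex[OF assms, of c] by simp
qed

lemma inner_face_simplex_eq_iff:
  fixes S :: "'v::finite set"
  assumes "x \<in> face_simplex S"
  shows "c \<bullet> x = height c S \<longleftrightarrow> x \<in> face_simplex (peak c S)"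
proof -
  have nn: "0 \<le> (height c S - c $ i) * x $ i" if "i \<in> S" for i
    using assms height_ge[OF that] by (simp add: mem_face_simplex)
  have "c \<bullet> x = height c S \<longleftrightarrow> (\<Sum>i\<in>S. (height c S - c $ i) * x $ i) = 0"
    using inner_face_simplex[OF assms, of c] by auto
  also have "\<dots> \<longleftrightarrow> (\<forall>i\<in>S. (height c S - c $ i) * x $ i = 0)"
    using nn by (intro sum_nonneg_eq_0_iff) auto
  also have "\<dots> \<longleftrightarrow> (\<forall>i. i \<notin> peak c S \<longrightarrow> x $ i = 0)"
  proof -
    have "x $ i = 0" if "i \<notin> S" for i
      using assms that by (simp add: mem_face_simplex)
    moreover have "(height c S - c $ i) * x $ i = 0 \<longleftrightarrow> c $ i = height c S \<or> x $ i = 0" for i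
      by auto
    ultimately show ?thesis
      by (metis mem_peak_iff)
  qed
  also have "\<dots> \<longleftrightarrow> x \<in> face_simplex (peak c S)"
  proof -
    have "(\<Sum>i\<in>peak c S. x $ i) = 1" if "\<forall>i. i \<notin> peak c S \<longrightarrow> x $ i = 0"
    proof -
      have "(\<Sum>i\<in>peak c S. x $ i) = (\<Sum>i\<in>S. x $ i)"
        by (rule sum.mono_neutral_left) (use that in \<open>auto simp: peak_def\<close>)
      then show ?thesis
        using assms by (simp add: mem_face_simplex)
    qed
    then show ?thesis
      using assms by (auto simp: mem_face_simplex)
  qed
  finally show ?thesis .
qed

definition graph_polytope :: "'v::finite rel \<Rightarrow> (real, 'v) vec set" where
  "graph_polytope E = (\<Sum>S\<in>{S. conn E S}. face_simplex S)"

text \<open>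
  The maximum of $c$ on a Minkowski sum is the sum of the maxima.
\<close>

definition face_towards :: "'v::finite rel \<Rightarrow> (real, 'v) vec \<Rightarrow> (real, 'v) vec set" where
  "face_towards E c = graph_polytope E \<inter> {x. c \<bullet> x = (\<Sum>S | conn E S. height c S)}"

lemma mem_graph_polytope:
  "x \<in> graph_polytope E \<longleftrightarrow> (\<exists>s. x = (\<Sum>S | conn E S. s S) \<and> (\<forall>S. conn E S \<longrightarrow> s S \<in> face_simplex S))"
  unfolding graph_polytope_def by (subst set_sum_alt) auto

lemma graph_polytope_polytope: "polytope (graph_polytope E)"
proof -
  have "finite (\<Sum>S\<in>A. (\<lambda>i. axis i (1::real)) ` S)" for A :: "'v::finite set set"
    by (induction A rule: infinite_finite_induct) (auto simp: finite_set_plus)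
  then show ?thesis
    unfolding graph_polytope_def face_simplex_def convex_hull_set_sum[symmetric]
    by (rule polytope_convex_hull)
qed

lemma inner_graph_polytope_le:
  assumes "x \<in> graph_polytope E"
  shows "c \<bullet> x \<le> (\<Sum>S | conn E S. height c S)"
proof -
  obtain s where s: "x = (\<Sum>S | conn E S. s S)" "\<And>S. conn E S \<Longrightarrow> s S \<in> face_simplex S"
    using assms by (auto simp: mem_graph_polytope)
  show ?thesis
    unfolding s(1) inner_sum_right by (rule sum_mono) (simp add: s(2) inner_face_simplex_le)
qed

text \<open>
  A sum attains the sum of the maxima only if every summand attains its own maximum.
\<close>

lemma mem_face_towards:
  "x \<in> face_towards E c \<longleftrightarrow>
    (\<exists>s. x = (\<Sum>S | conn E S. s S) \<and> (\<forall>S. conn E S \<longrightarrow> s S \<in> face_simplex (peak c S)))"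
proof
  assume x: "x \<in> face_towards E c"
  then obtain s where s: "x = (\<Sum>S | conn E S. s S)" "\<And>S. conn E S \<Longrightarrow> s S \<in> face_simplex S"
    by (auto simp: face_towards_def mem_graph_polytope)
  have "(\<Sum>S | conn E S. c \<bullet> s S) = (\<Sum>S | conn E S. height c S)"
    using x by (simp add: face_towards_def s(1) inner_sum_right)
  then have "c \<bullet> s S = height c S" if "conn E S" for S
    using that s(2) by (intro sum_mono_inv[of "\<lambda>S. c \<bullet> s S" "{S. conn E S}"]) (auto intro: inner_face_simplex_le)
  then show "\<exists>s. x = (\<Sum>S | conn E S. s S) \<and> (\<forall>S. conn E S \<longrightarrow> s S \<in> face_simplex (peak c S))"
    using s inner_face_simplex_eq_iff by blast
next
  assume "\<exists>s. x = (\<Sum>S | conn E S. s S) \<and> (\<forall>S. conn E S \<longrightarrow> s S \<in> face_simplex (peak c S))"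
  then obtain s where s: "x = (\<Sum>S | conn E S. s S)" "\<And>S. conn E S \<Longrightarrow> s S \<in> face_simplex (peak c S)"
    by blast
  have sub: "face_simplex (peak c S) \<subseteq> face_simplex S" for S
    unfolding face_simplex_def by (intro hull_mono image_mono) (auto simp: peak_def)
  have "c \<bullet> s S = height c S" if "conn E S" for S
    using s(2)[OF that] sub inner_face_simplex_eq_iff by blast
  then have "c \<bullet> x = (\<Sum>S | conn E S. height c S)"
    by (simp add: s(1) inner_sum_right)
  moreover have "x \<in> graph_polytope E"
    unfolding mem_graph_polytope using s sub by (intro exI[of _ s]) blast
  ultimately show "x \<in> face_towards E c"
    by (simp add: face_towards_def)
qed

text \<open>
  The summand of this point in each simplex is positive on all maximal points of $c$, so the maximality of
  another functional at this point passes to all of them.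
\<close>

definition center :: "'v::finite rel \<Rightarrow> (real, 'v) vec \<Rightarrow> (real, 'v) vec" where
  "center E c = (\<Sum>S | conn E S. barycenter (peak c S))"

lemma center_mem: "center E c \<in> face_towards E c"
  unfolding mem_face_towards center_def
  by (intro exI[of _ "\<lambda>S. barycenter (peak c S)"] conjI refl allI impI
    barycenter_mem peak_nonempty order_refl) (rule conn_nonempty)

text \<open>
  Faces of polyhedra are exposed, and the supporting value of a nonempty exposed face is the maximum.
\<close>

lemma nonempty_face_iff:
  "F face_of graph_polytope E \<and> F \<noteq> {} \<longleftrightarrow> F \<in> range (face_towards E)"
proof
  note exposed_iff = exposed_face_of_polyhedron[OF polytope_imp_polyhedron[OF graph_polytope_polytope]]
  assume F: "F face_of graph_polytope E \<and> F \<noteq> {}"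
  have "F exposed_face_of graph_polytope E"
    using F by (intro iffD2[OF exposed_iff]) simp
  then have "\<exists>a b. graph_polytope E \<subseteq> {x. a \<bullet> x \<le> b} \<and> F = graph_polytope E \<inter> {x. a \<bullet> x = b}"
    unfolding exposed_face_of_def by (rule conjunct2)
  then obtain a b where ab: "graph_polytope E \<subseteq> {x. a \<bullet> x \<le> b}" "F = graph_polytope E \<inter> {x. a \<bullet> x = b}"
    by (elim exE conjE)
  obtain x where x: "x \<in> F" using F by auto
  have "b \<le> (\<Sum>S | conn E S. height a S)"
    using inner_graph_polytope_le[of x E a] x ab(2) by simp
  moreover have "(\<Sum>S | conn E S. height a S) \<le> b"
  proof -
    have "center E a \<in> graph_polytope E" "a \<bullet> center E a = (\<Sum>S | conn E S. height a S)"
      using center_mem[of E a] by (simp_all add: face_towards_def)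
    then show ?thesis
      using ab(1) by auto
  qed
  ultimately have "b = (\<Sum>S | conn E S. height a S)"
    by (rule antisym)
  then have "F = face_towards E a"
    using ab(2) by (simp only: face_towards_def)
  then show "F \<in> range (face_towards E)" by simp
next
  assume "F \<in> range (face_towards E)"
  then obtain c where c: "F = face_towards E c" by auto
  have "convex (graph_polytope E)"
    by (rule polytope_imp_convex[OF graph_polytope_polytope])
  then have "F exposed_face_of graph_polytope E"
    unfolding c face_towards_def
    by (intro exposed_face_of_Int_supporting_hyperplane_le inner_graph_polytope_le)
  then have "F face_of graph_polytope E"
    unfolding exposed_face_of_def by (rule conjunct1)
  moreover have "center E c \<in> F"
    unfolding c by (rule center_mem)
  ultimately show "F face_of graph_polytope E \<and> F \<noteq> {}"
    by auto
qed

lemma peak_subset_if_face_eq: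
  assumes "face_towards E c = face_towards E c'" "conn E S"
  shows "peak c S \<subseteq> peak c' S"
proof -
  have mem: "barycenter (peak c S) \<in> face_simplex S" if "conn E S" for S
    using peak_nonempty[OF conn_nonempty[OF that]] by (intro barycenter_mem) (auto simp: peak_def)
  have "center E c \<in> face_towards E c'"
    using center_mem[of E c] by (simp only: assms(1))
  then have "(\<Sum>S | conn E S. c' \<bullet> barycenter (peak c S)) = (\<Sum>S | conn E S. height c' S)"
    by (simp add: face_towards_def center_def inner_sum_right)
  then have "c' \<bullet> barycenter (peak c S) = height c' S"
    using assms(2) mem
    by (intro sum_mono_inv[of "\<lambda>S. c' \<bullet> barycenter (peak c S)" "{S. conn E S}"]) (auto intro: inner_face_simplex_le)
  then have "barycenter (peak c S) \<in> face_simplex (peak c' S)"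
    using inner_face_simplex_eq_iff[OF mem[OF assms(2)]] by simp
  then show ?thesis
    using barycenter_mem_iff[OF peak_nonempty[OF conn_nonempty[OF assms(2)]]] by simp
qed

abbreviation tube_of :: "'v::finite rel \<Rightarrow> (real, 'v) vec \<Rightarrow> 'v \<Rightarrow> 'v set" where
  "tube_of E c \<equiv> tube E (($) c) UNIV"

abbreviation nest_of :: "'v::finite rel \<Rightarrow> (real, 'v) vec \<Rightarrow> 'v set set" where
  "nest_of E c \<equiv> nest E UNIV (($) c)"

lemma mem_peak_iff_tube:
  assumes "conn E S"
  shows "v \<in> peak c S \<longleftrightarrow> v \<in> S \<and> S \<subseteq> tube_of E c v"
proof -
  have "S \<subseteq> tube_of E c v \<longleftrightarrow> S \<subseteq> level (($) c) UNIV v" if "v \<in> S"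
    using tube_maximal[OF assms that, of "($) c" UNIV] tube_subset_level[of E "($) c" UNIV v]
    by (metis subset_trans)
  moreover have "v \<in> peak c S \<longleftrightarrow> v \<in> S \<and> S \<subseteq> level (($) c) UNIV v"
    by (auto simp: peak_def level_def)
  ultimately show ?thesis by metis
qed

lemma tube_of_subset:
  assumes "v \<in> tube_of E c w"
  shows "tube_of E c v \<subseteq> tube_of E c w"
proof -
  have v: "c $ v \<le> c $ w"
    using subsetD[OF tube_subset_level assms] by (simp add: level_def)
  have "conn E (\<Union>{tube_of E c v, tube_of E c w})"
    using assms mem_tube[of v UNIV E "($) c"] by (intro conn_Union[where v = v]) (auto simp: conn_tube)
  moreover have "tube_of E c v \<subseteq> level (($) c) UNIV v" "tube_of E c w \<subseteq> level (($) c) UNIV w"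
    by (rule tube_subset_level)+
  moreover have "level (($) c) UNIV v \<subseteq> level (($) c) UNIV w"
    using v by (auto simp: level_def)
  ultimately have "\<Union>{tube_of E c v, tube_of E c w} \<subseteq> tube_of E c w"
    using mem_tube[of w UNIV E "($) c"] by (intro tube_maximal) simp_all
  then show ?thesis by simp
qed

text \<open>
  The family of tubes determines which vertex has which tube, so it carries the same information as the
  sets of maximal points.
\<close>

lemma tube_of_eq_Inter: "tube_of E c v = \<Inter>{X \<in> nest_of E c. v \<in> X}"
proof -
  have "tube_of E c v \<in> {X \<in> nest_of E c. v \<in> X}"
    by (simp add: nest_def mem_tube)
  moreover have "tube_of E c v \<subseteq> X" if X: "X \<in> {X \<in> nest_of E c. v \<in> X}" for X
  proof -
    obtain w where "X = tube_of E c w" "v \<in> X"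
      using X unfolding nest_def by blast
    then show ?thesis
      using tube_of_subset by simp
  qed
  ultimately show ?thesis
    by (intro equalityI Inter_greatest Inter_lower)
qed

theorem face_towards_eq_iff:
  "face_towards E c = face_towards E c' \<longleftrightarrow> nest_of E c = nest_of E c'"
proof
  assume eq: "face_towards E c = face_towards E c'"
  have "peak c S = peak c' S" if "conn E S" for S
    using peak_subset_if_face_eq[OF eq that] peak_subset_if_face_eq[OF eq[symmetric] that] by blast
  then have peak: "v \<in> S \<and> S \<subseteq> level (($) c) UNIV v \<longleftrightarrow> v \<in> S \<and> S \<subseteq> level (($) c') UNIV v"
    if "conn E S" for S v
    using that by (fastforce simp: peak_def level_def)
  have "tube_of E c v = tube_of E c' v" for v
    unfolding tube_def using peak by (intro arg_cong[where f = Union] Collect_cong) blast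
  then show "nest_of E c = nest_of E c'"
    by (simp add: nest_def)
next
  assume "nest_of E c = nest_of E c'"
  then have "tube_of E c v = tube_of E c' v" for v
    by (simp only: tube_of_eq_Inter)
  then have "peak c S = peak c' S" if "conn E S" for S
    using mem_peak_iff_tube[OF that] by (intro set_eqI) simp
  then show "face_towards E c = face_towards E c'"
    by (intro set_eqI) (simp add: mem_face_towards)
qed

definition ind :: "'v::finite rel \<Rightarrow> (real, 'v) vec \<Rightarrow> 'v set \<Rightarrow> (real, 'v) vec" where
  "ind E c X = (\<chi> i. if tube_of E c i = X then 1 else 0)"

lemma inner_ind: "ind E c X \<bullet> x = (\<Sum>i | tube_of E c i = X. x $ i)"
  by (simp add: ind_def inner_vec_def if_distrib[of "\<lambda>a. a * _"] sum.If_cases cong: if_cong)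

lemma tube_of_peak:
  assumes "conn E S" "i \<in> peak c S" "j \<in> peak c S"
  shows "tube_of E c i = tube_of E c j"
proof -
  have "j \<in> tube_of E c i" "i \<in> tube_of E c j"
    using assms(2,3) unfolding mem_peak_iff_tube[OF assms(1)] by auto
  then show ?thesis
    by (intro equalityI tube_of_subset)
qed

lemma inner_ind_face_simplex:
  fixes S :: "'v::finite set"
  assumes "conn E S" "i \<in> peak c S" "x \<in> face_simplex (peak c S)"
  shows "ind E c X \<bullet> x = (if tube_of E c i = X then 1 else 0)"
proof -
  have "ind E c X \<bullet> x = (\<Sum>j\<in>UNIV. (if tube_of E c j = X then 1 else 0) * x $ j)"
    by (simp add: ind_def inner_vec_def)
  also have "\<dots> = (\<Sum>j\<in>UNIV. (if tube_of E c i = X then 1 else 0) * x $ j)"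
  proof (rule sum.cong[OF refl])
    fix j
    show "(if tube_of E c j = X then 1 else 0) * x $ j = (if tube_of E c i = X then 1 else 0) * x $ j"
    proof (cases "j \<in> peak c S")
      case True
      then show ?thesis using tube_of_peak[OF assms(1,2)] by simp
    next
      case False
      then show ?thesis using assms(3) by (simp add: mem_face_simplex)
    qed
  qed
  also have "\<dots> = (if tube_of E c i = X then 1 else 0) * (\<Sum>j\<in>UNIV. x $ j)"
    by (simp only: sum_distrib_left)
  also have "(\<Sum>j\<in>UNIV. x $ j) = (\<Sum>j\<in>peak c S. x $ j)"
    by (rule sum.mono_neutral_right) (use assms(3) in \<open>auto simp: mem_face_simplex\<close>)
  finally show ?thesis
    using assms(3) by (simp add: mem_face_simplex)
qed

text \<open>
  On the face, the coordinates over the vertices with a common tube have a constant sum, since each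
  \<open>peak c S\<close> consists of vertices with a common tube. Hence the directions of the face are orthogonal
  to the indicator vectors of these classes, one for each tube. Conversely the face contains enough
  points: for vertices $i$ and $j$ with a common tube, the simplex over this tube may contribute
  $e_i$ or $e_j$, so $e_i - e_j$ is a direction.
\<close>

theorem aff_dim_face_towards:
  fixes E :: "'v::finite rel"
  shows "aff_dim (face_towards E c) = int (CARD('v) - card (nest_of E c))"
proof -
  define I where "I = ind E c ` nest_of E c"
  define L where "L = {x. \<forall>y\<in>I. orthogonal x y}"
  define T where "T = (+) (- center E c) ` face_towards E c"
  have dimT: "aff_dim (face_towards E c) = int (dim T)"
    unfolding T_def using center_mem by (intro aff_dim_eq_dim hull_inc)
  have "T \<subseteq> L"
  proof
    fix z assume "z \<in> T"
    then obtain x where x: "x \<in> face_towards E c" "z = x - center E c"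
      by (auto simp: T_def)
    obtain s where s: "x = (\<Sum>S | conn E S. s S)" "\<And>S. conn E S \<Longrightarrow> s S \<in> face_simplex (peak c S)"
      using x(1) by (auto simp: mem_face_towards)
    have "ind E c X \<bullet> s S = ind E c X \<bullet> barycenter (peak c S)" if "conn E S" for X S
    proof -
      have ne: "peak c S \<noteq> {}"
        using that by (intro peak_nonempty conn_nonempty)
      then obtain i where "i \<in> peak c S" by blast
      then show ?thesis
        using inner_ind_face_simplex[OF that _ s(2)[OF that]]
          inner_ind_face_simplex[OF that _ barycenter_mem[OF ne order_refl]] by metis
    qed
    then have "ind E c X \<bullet> x = ind E c X \<bullet> center E c" for X
      by (simp add: s(1) center_def inner_sum_right)
    then have "z \<bullet> ind E c X = 0" for X
      by (simp add: x(2) inner_commute[of "x - center E c"] inner_diff_right)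
    then show "z \<in> L"
      by (auto simp: L_def I_def orthogonal_def)
  qed
  have axis_diff: "axis i 1 - axis j 1 \<in> span T" if ij: "tube_of E c i = tube_of E c j" for i j
  proof -
    let ?S = "tube_of E c i"
    \<comment> \<open>The points p i and p j of the face differ in one summand only.\<close>
    define p where "p k = (\<Sum>S | conn E S. if S = ?S then axis k 1 else barycenter (peak c S))" for k
    have cS: "conn E ?S"
      by (simp add: conn_tube)
    have peak: "i \<in> peak c ?S" "j \<in> peak c ?S"
      using mem_peak_iff_tube[OF cS] ij mem_tube[of _ UNIV E] by (metis UNIV_I order_refl)+
    have "p k \<in> face_towards E c" if k: "k \<in> peak c ?S" for k
    proof -
      have "(if S = ?S then axis k 1 else barycenter (peak c S)) \<in> face_simplex (peak c S)"
        if "conn E S" for S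
        using k that
        by (cases "S = ?S") (simp_all add: axis_mem_face_simplex barycenter_mem peak_nonempty conn_nonempty)
      then show ?thesis
        unfolding mem_face_towards p_def
        by (intro exI[of _ "\<lambda>S. if S = ?S then axis k 1 else barycenter (peak c S)"]) simp
    qed
    then have "p i - center E c \<in> T" "p j - center E c \<in> T"
      using peak by (auto simp: T_def image_iff)
    then have "(p i - center E c) - (p j - center E c) \<in> span T"
      by (intro span_diff span_base)
    moreover have "p i - p j = (\<Sum>S | conn E S. if S = ?S then axis i 1 - axis j 1 else 0)"
      unfolding p_def sum_subtractf[symmetric] by (rule sum.cong) auto
    then have "p i - p j = axis i 1 - axis j 1"
      using cS by simp
    ultimately show ?thesis by simp
  qed
  have "L \<subseteq> span T"
  proof
    fix x assume x: "x \<in> L"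
    \<comment> \<open>A representative of each class: vectors with zero class sums are combinations of e_i - e_(r i).\<close>
    define r where "r X = (SOME j. tube_of E c j = X)" for X
    have r: "tube_of E c (r (tube_of E c i)) = tube_of E c i" for i
      unfolding r_def by (rule someI) (rule refl)
    have "(\<Sum>i\<in>UNIV. (x $ i) *\<^sub>R axis (r (tube_of E c i)) (1::real)) = 0"
    proof (subst vec_eq_iff, intro allI)
      fix k
      have "(\<Sum>i\<in>UNIV. (x $ i) *\<^sub>R axis (r (tube_of E c i)) (1::real)) $ k =
          (\<Sum>i | r (tube_of E c i) = k. x $ i)"
        by (simp add: axis_def if_distrib[of "\<lambda>a. _ * a"] sum.If_cases eq_commute[of k] cong: if_cong)
      also have "\<dots> = 0"
      proof (cases "r (tube_of E c k) = k")
        case True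
        then have "{i. r (tube_of E c i) = k} = {i. tube_of E c i = tube_of E c k}"
          using r by metis
        moreover have "ind E c (tube_of E c k) \<bullet> x = 0"
          using x by (simp add: L_def I_def nest_def orthogonal_def inner_commute)
        ultimately show ?thesis
          by (simp add: inner_ind)
      next
        case False
        then have "{i. r (tube_of E c i) = k} = {}"
          using r by force
        then show ?thesis by simp
      qed
      finally show "(\<Sum>i\<in>UNIV. (x $ i) *\<^sub>R axis (r (tube_of E c i)) (1::real)) $ k = 0 $ k"
        by simp
    qed
    moreover have "x = (\<Sum>i\<in>UNIV. (x $ i) *\<^sub>R axis i 1)"
      using basis_expansion[of x] by (simp add: scalar_mult_eq_scaleR)
    ultimately have "x = (\<Sum>i\<in>UNIV. (x $ i) *\<^sub>R (axis i 1 - axis (r (tube_of E c i)) 1))"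
      by (simp add: scaleR_diff_right sum_subtractf)
    also have "\<dots> \<in> span T"
      using r by (intro span_sum span_scale axis_diff) simp
    finally show "x \<in> span T" .
  qed
  have "dim T = dim L"
    using \<open>T \<subseteq> L\<close> \<open>L \<subseteq> span T\<close> by (metis dim_span dim_subset le_antisym)
  moreover have "dim L + card (nest_of E c) = CARD('v)"
  proof -
    have ind_self: "ind E c X \<bullet> ind E c X \<noteq> 0" if X: "X \<in> nest_of E c" for X
    proof -
      obtain i where "tube_of E c i = X"
        using X by (auto simp: nest_def)
      then have "ind E c X $ i = 1"
        by (simp add: ind_def)
      then show ?thesis
        by auto
    qed
    have orth: "ind E c X \<bullet> ind E c Y = 0" if "X \<noteq> Y" for X Y
      unfolding inner_ind by (rule sum.neutral) (use that in \<open>auto simp: ind_def\<close>)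
    have "pairwise orthogonal I"
      unfolding pairwise_def
    proof (intro ballI impI)
      fix y z assume "y \<in> I" "z \<in> I" "y \<noteq> z"
      then obtain Y Z where "y = ind E c Y" "z = ind E c Z" "Y \<noteq> Z"
        unfolding I_def by blast
      then show "orthogonal y z"
        using orth by (simp add: orthogonal_def)
    qed
    moreover have "0 \<notin> I"
      using ind_self by (auto simp: I_def)
    ultimately have "independent I"
      by (rule pairwise_orthogonal_independent)
    then have "dim I = card I"
      by (rule dim_eq_card_independent)
    also have "inj_on (ind E c) (nest_of E c)"
      using orth ind_self by (metis inj_onI)
    then have "card I = card (nest_of E c)"
      unfolding I_def by (rule card_image)
    finally have dimI: "dim (span I) = card (nest_of E c)"
      by simp
    have "L = {y \<in> UNIV. \<forall>x\<in>span I. orthogonal x y}"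
    proof (intro equalityI subsetI)
      fix y assume "y \<in> L"
      then have "\<And>x. x \<in> I \<Longrightarrow> orthogonal y x" by (simp add: L_def)
      then show "y \<in> {y \<in> UNIV. \<forall>x\<in>span I. orthogonal x y}"
        using orthogonal_to_span[of _ I y] by (auto simp: orthogonal_commute)
    next
      fix y assume "y \<in> {y \<in> UNIV. \<forall>x\<in>span I. orthogonal x y}"
      then show "y \<in> L"
        by (auto simp: L_def orthogonal_commute intro: span_base)
    qed
    then have "dim L + dim (span I) = dim (UNIV :: (real, 'v) vec set)"
      using dim_subspace_orthogonal_to_vectors[of "span I" UNIV] by simp
    then show ?thesis
      using dimI by simp
  qed
  ultimately show ?thesis
    using dimT by simp
qed

lemma card_image_eq_of_same_fibres:
  assumes "\<And>x y. x \<in> A \<Longrightarrow> y \<in> A \<Longrightarrow> f x = f y \<longleftrightarrow> g x = g y"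
  shows "card (f ` A) = card (g ` A)"
proof (rule bij_betw_same_card)
  have inv: "inv_into A f y \<in> A" "f (inv_into A f y) = y" if "y \<in> f ` A" for y
    using that by (auto intro: inv_into_into f_inv_into_f)
  show "bij_betw (\<lambda>y. g (inv_into A f y)) (f ` A) (g ` A)"
  proof (rule bij_betw_imageI)
    show "inj_on (\<lambda>y. g (inv_into A f y)) (f ` A)"
    proof (rule inj_onI)
      fix y z assume yz: "y \<in> f ` A" "z \<in> f ` A" "g (inv_into A f y) = g (inv_into A f z)"
      then have "f (inv_into A f y) = f (inv_into A f z)"
        using assms inv(1) by simp
      then show "y = z"
        using yz inv(2) by simp
    qed
    have "g (inv_into A f (f x)) = g x" if "x \<in> A" for x
      using inv[of "f x"] assms[of "inv_into A f (f x)" x] that by simp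
    then show "(\<lambda>y. g (inv_into A f y)) ` f ` A = g ` A"
      by (simp add: image_image)
  qed
qed

theorem f_num_graph_polytope:
  fixes E :: "'v::finite rel"
  shows "f_num (graph_polytope E) i = card {N \<in> nests E UNIV. CARD('v) - card N = i}"
proof -
  define A where "A = {c. CARD('v) - card (nest_of E c) = i}"
  have "{F. F face_of graph_polytope E \<and> aff_dim F = int i} = face_towards E ` A"
  proof (intro set_eqI iffI)
    fix F assume F: "F \<in> {F. F face_of graph_polytope E \<and> aff_dim F = int i}"
    then have "F \<noteq> {}" by auto
    then obtain c where "F = face_towards E c"
      using F nonempty_face_iff by blast
    then show "F \<in> face_towards E ` A"
      using F aff_dim_face_towards[of E c] by (auto simp: A_def)
  next
    fix F assume "F \<in> face_towards E ` A"
    then obtain c where c: "F = face_towards E c" "CARD('v) - card (nest_of E c) = i"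
      by (auto simp: A_def)
    then show "F \<in> {F. F face_of graph_polytope E \<and> aff_dim F = int i}"
      using nonempty_face_iff[of F E] aff_dim_face_towards[of E c] by auto
  qed
  moreover have "{N \<in> nests E UNIV. CARD('v) - card N = i} = nest_of E ` A"
  proof -
    have "nest E UNIV f \<in> range (nest_of E)" for f
    proof -
      have "nest E UNIV f = nest_of E (\<chi> i. f i)"
        by (rule nest_cong) simp_all
      then show ?thesis by (rule range_eqI)
    qed
    then have "nests E UNIV = range (nest_of E)"
      unfolding nests_def by (intro equalityI image_subsetI) (assumption | rule rangeI)+
    then show ?thesis
      by (auto simp: A_def)
  qed
  moreover have "card (face_towards E ` A) = card (nest_of E ` A)"
    by (rule card_image_eq_of_same_fibres) (rule face_towards_eq_iff)
  ultimately show ?thesis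
    by (simp only: f_num_def)
qed

section \<open>From faces to the gamma-vector\<close>

lemma poly_dim_graph_polytope:
  fixes E :: "'v::finite rel"
  assumes "conn E (UNIV :: 'v set)"
  shows "poly_dim (graph_polytope E) = CARD('v) - 1"
proof -
  have "height 0 S = 0" if "S \<noteq> {}" for S :: "'v set"
    using that by (simp add: height_def)
  then have "(\<Sum>S | conn E S. height 0 S) = 0"
    by (intro sum.neutral) (simp add: conn_nonempty)
  then have "graph_polytope E = face_towards E 0"
    by (simp add: face_towards_def)
  moreover have "tube_of E 0 v = UNIV" for v
    using tube_maximal[OF assms, of v "($) 0" UNIV] by (auto simp: level_def)
  then have "nest_of E 0 = {UNIV}"
    by (simp add: nest_def)
  ultimately show ?thesis
    using aff_dim_face_towards[of E 0] by (simp add: poly_dim_def)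
qed

lemma pcompose_power: "pcompose (p ^ n) q = pcompose p q ^ n"
  by (induction n) (simp_all add: pcompose_mult pcompose_1)

lemma pcompose_var: "pcompose alpha_var q = q" "pcompose t_var q = t_var"
  by (simp_all add: alpha_var_def t_var_def pcompose_pCons)

lemma F_poly_graph_polytope:
  fixes E :: "'v::finite rel"
  assumes "conn E (UNIV :: 'v set)"
  shows "F_poly (graph_polytope E) =
    (\<Sum>N\<in>nests E UNIV. alpha_var ^ (CARD('v) - card N) * t_var ^ (card N - 1))"
proof -
  let ?n = "CARD('v) - 1"
  have card_N: "1 \<le> card N" "card N \<le> CARD('v)" if "N \<in> nests E (UNIV :: 'v set)" for N
  proof -
    have "N \<noteq> {}"
      using Union_nest[OF that] by auto
    then show "1 \<le> card N"
      by (simp add: Suc_le_eq card_gt_0_iff)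
    show "card N \<le> CARD('v)"
      using card_nest_le[OF that] .
  qed
  have "F_poly (graph_polytope E) = (\<Sum>i\<le>?n. \<Sum>N | N \<in> nests E UNIV \<and> CARD('v) - card N = i.
      alpha_var ^ (CARD('v) - card N) * t_var ^ (card N - 1))"
    unfolding F_poly_def poly_dim_graph_polytope[OF assms]
  proof (rule sum.cong[OF refl])
    fix i assume "i \<in> {..?n}"
    have "(\<Sum>N | N \<in> nests E UNIV \<and> CARD('v) - card N = i.
        alpha_var ^ (CARD('v) - card N) * t_var ^ (card N - 1)) =
      (\<Sum>N | N \<in> nests E (UNIV :: 'v set) \<and> CARD('v) - card N = i. alpha_var ^ i * t_var ^ (?n - i))"
    proof (rule sum.cong[OF refl], clarify)
      fix N assume N: "N \<in> nests E (UNIV :: 'v set)" "i = CARD('v) - card N"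
      have "card N - 1 = ?n - (CARD('v) - card N)"
        using card_N[OF N(1)] by linarith
      then show "alpha_var ^ (CARD('v) - card N) * t_var ^ (card N - 1) =
          alpha_var ^ (CARD('v) - card N) * t_var ^ (?n - (CARD('v) - card N))"
        by simp
    qed
    also have "\<dots> = of_nat (f_num (graph_polytope E) i) * alpha_var ^ i * t_var ^ (?n - i)"
      by (simp add: f_num_graph_polytope mult.assoc)
    finally show "of_nat (f_num (graph_polytope E) i) * alpha_var ^ i * t_var ^ (?n - i) =
      (\<Sum>N | N \<in> nests E UNIV \<and> CARD('v) - card N = i.
        alpha_var ^ (CARD('v) - card N) * t_var ^ (card N - 1))" ..
  qed
  also have "\<dots> = (\<Sum>N\<in>nests E UNIV. alpha_var ^ (CARD('v) - card N) * t_var ^ (card N - 1))"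
    using card_N(1) by (intro sum.group) (simp_all add: image_subset_iff diff_le_mono2)
  finally show ?thesis .
qed

theorem H_poly_graph_polytope:
  fixes E :: "'v::finite rel"
  assumes "conn E (UNIV :: 'v set)"
  shows "H_poly (graph_polytope E) = hpoly E UNIV"
  unfolding H_poly_def F_poly_graph_polytope[OF assms] hpoly_def
  by (simp add: pcompose_sum pcompose_mult pcompose_power pcompose_var)

section \<open>Coefficients of symmetric polynomials\<close>

lemma coeff_alpha_t:
  "coeff (coeff (alpha_var ^ p * t_var ^ q) a) b = (if a = p \<and> b = q then 1 else 0)"
proof -
  have "alpha_var ^ p = monom 1 p"
    by (simp add: alpha_var_def monom_altdef)
  moreover have "t_var ^ q = [:monom 1 q:]"
    by (induction q) (simp_all add: t_var_def monom_altdef one_pCons)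
  ultimately have "alpha_var ^ p * t_var ^ q = monom (monom 1 q) p"
    by (simp add: monom_altdef mult.commute)
  then show ?thesis
    by simp
qed

lemma coeff_gamma_term:
  assumes "2 * i \<le> n" "k \<le> n"
  shows "coeff (coeff ((alpha_var * t_var) ^ i * (alpha_var + t_var) ^ (n - 2 * i)) (n - k)) k =
    (if i \<le> k then int ((n - 2 * i) choose (k - i)) else 0)"
proof -
  let ?m = "n - 2 * i"
  have "(alpha_var * t_var) ^ i * (alpha_var + t_var) ^ ?m =
      (\<Sum>j\<le>?m. of_nat (?m choose j) * (alpha_var ^ (i + (?m - j)) * t_var ^ (i + j)))"
    unfolding add.commute[of alpha_var t_var] binomial_ring sum_distrib_left
    by (simp add: power_add power_mult_distrib mult_ac)
  then have "coeff (coeff ((alpha_var * t_var) ^ i * (alpha_var + t_var) ^ ?m) (n - k)) k =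
      (\<Sum>j\<le>?m. int (?m choose j) * (if n - k = i + (?m - j) \<and> k = i + j then 1 else 0))"
    by (simp add: coeff_sum coeff_alpha_t of_nat_poly)
  also have "\<dots> = (\<Sum>j\<le>?m. if i \<le> k \<and> j = k - i then int (?m choose j) else 0)"
    by (rule sum.cong[OF refl]) (use assms in auto)
  also have "\<dots> = (if i \<le> k then int (?m choose (k - i)) else 0)"
    by (simp add: binomial_eq_0)
  finally show ?thesis .
qed

lemma coeff_gamma_sum:
  assumes "k \<le> n"
  shows "coeff (coeff (gamma_sum n c) (n - k)) k =
    (\<Sum>i\<le>n div 2. c i * (if i \<le> k then int ((n - 2 * i) choose (k - i)) else 0))"
proof -
  have "coeff (coeff (gamma_sum n c) (n - k)) k =
      (\<Sum>i\<le>n div 2. coeff (coeff (of_int (c i) * ((alpha_var * t_var) ^ i * (alpha_var + t_var) ^ (n - 2 * i))) (n - k)) k)"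
    by (simp add: gamma_sum_def coeff_sum mult.assoc)
  also have "\<dots> = (\<Sum>i\<le>n div 2. c i * (if i \<le> k then int ((n - 2 * i) choose (k - i)) else 0))"
  proof (rule sum.cong[OF refl])
    fix i assume "i \<in> {..n div 2}"
    then have "2 * i \<le> n" by auto
    then show "coeff (coeff (of_int (c i) * ((alpha_var * t_var) ^ i * (alpha_var + t_var) ^ (n - 2 * i))) (n - k)) k =
        c i * (if i \<le> k then int ((n - 2 * i) choose (k - i)) else 0)"
      using coeff_gamma_term[OF _ assms] by (simp add: of_int_poly)
  qed
  finally show ?thesis .
qed

text \<open>
  The coefficient of $\alpha^{n-k} t^k$ involves only $c_0, \dots, c_k$, and $c_k$ with coefficient one.
\<close>

lemma gamma_sum_inject:
  assumes "gamma_sum n c = gamma_sum n d" "k \<le> n div 2"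
  shows "c k = d k"
  using assms(2)
proof (induction k rule: less_induct)
  case (less k)
  have split: "(\<Sum>i\<le>n div 2. e i * (if i \<le> k then int ((n - 2 * i) choose (k - i)) else 0)) =
      (\<Sum>i<k. e i * int ((n - 2 * i) choose (k - i))) + e k" for e :: "nat \<Rightarrow> int"
  proof -
    have "(\<Sum>i\<le>n div 2. e i * (if i \<le> k then int ((n - 2 * i) choose (k - i)) else 0)) =
        (\<Sum>i\<le>k. e i * int ((n - 2 * i) choose (k - i)))"
      using less.prems by (intro sum.mono_neutral_cong_right) auto
    also have "\<dots> = (\<Sum>i<k. e i * int ((n - 2 * i) choose (k - i))) + e k"
      by (simp add: lessThan_Suc_atMost[symmetric])
    finally show ?thesis .
  qed
  have k: "k \<le> n" using less.prems by linarith
  have "(\<Sum>i<k. c i * int ((n - 2 * i) choose (k - i))) + c k =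
      (\<Sum>i<k. d i * int ((n - 2 * i) choose (k - i))) + d k"
    using coeff_gamma_sum[OF k, of c] coeff_gamma_sum[OF k, of d] assms(1) unfolding split by simp
  moreover have "(\<Sum>i<k. c i * int ((n - 2 * i) choose (k - i))) =
      (\<Sum>i<k. d i * int ((n - 2 * i) choose (k - i)))"
    using less by (intro sum.cong) auto
  ultimately show ?case by simp
qed

lemma gamma_num_eq:
  assumes "H_poly P = gamma_sum (poly_dim P) c" "\<And>i. i > poly_dim P div 2 \<Longrightarrow> c i = 0"
  shows "gamma_num P = c"
  unfolding gamma_num_def
proof (rule the_equality)
  show "(\<forall>i>poly_dim P div 2. c i = 0) \<and> H_poly P = (\<Sum>i\<le>poly_dim P div 2.
      of_int (c i) * (alpha_var * t_var) ^ i * (alpha_var + t_var) ^ (poly_dim P - 2 * i))"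
    using assms by (simp add: gamma_sum_def)
next
  fix d assume d: "(\<forall>i>poly_dim P div 2. d i = 0) \<and> H_poly P = (\<Sum>i\<le>poly_dim P div 2.
      of_int (d i) * (alpha_var * t_var) ^ i * (alpha_var + t_var) ^ (poly_dim P - 2 * i))"
  then have "gamma_sum (poly_dim P) d = gamma_sum (poly_dim P) c"
    using assms(1) by (simp add: gamma_sum_def)
  then show "d = c"
    using gamma_sum_inject d assms(2) by (metis ext not_le)
qed

definition nonneg_coeffs :: "int poly poly \<Rightarrow> bool" where
  "nonneg_coeffs p \<longleftrightarrow> (\<forall>i j. 0 \<le> coeff (coeff p i) j)"

lemma nonneg_coeffs_add: "nonneg_coeffs p \<Longrightarrow> nonneg_coeffs q \<Longrightarrow> nonneg_coeffs (p + q)"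
  by (simp add: nonneg_coeffs_def)

lemma nonneg_coeffs_mult: "nonneg_coeffs p \<Longrightarrow> nonneg_coeffs q \<Longrightarrow> nonneg_coeffs (p * q)"
  by (simp add: nonneg_coeffs_def coeff_mult coeff_sum sum_nonneg)

lemma nonneg_coeffs_of_int: "0 \<le> k \<Longrightarrow> nonneg_coeffs (of_int k)"
  by (simp add: nonneg_coeffs_def of_int_poly coeff_pCons split: nat.split)

lemma nonneg_coeffs_power: "nonneg_coeffs p \<Longrightarrow> nonneg_coeffs (p ^ n)"
proof (induction n)
  case 0
  then show ?case using nonneg_coeffs_of_int[of 1] by simp
qed (simp add: nonneg_coeffs_mult)

lemma nonneg_coeffs_sum: "(\<And>i. i \<in> I \<Longrightarrow> nonneg_coeffs (f i)) \<Longrightarrow> nonneg_coeffs (sum f I)"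
  by (simp add: nonneg_coeffs_def coeff_sum sum_nonneg)

lemma nonneg_coeffs_vars: "nonneg_coeffs alpha_var" "nonneg_coeffs t_var"
  by (simp_all add: nonneg_coeffs_def alpha_var_def t_var_def coeff_pCons split: nat.split)

text \<open>
  The substitution turns $\alpha t$ and $\alpha + t$ into $(\alpha + t) t$ and $\alpha + 2t$.
\<close>

lemma nonneg_coeffs_pcompose_gamma_cone:
  assumes "p \<in> gamma_cone n"
  shows "nonneg_coeffs (pcompose p (alpha_var + t_var))"
  using assms
proof (rule gamma_coneE)
  fix c assume c: "p = gamma_sum n c" "\<And>i. 0 \<le> c i"
  have "pcompose (of_int k) q = of_int k" for k :: int and q :: "int poly poly"
    by (simp add: of_int_poly)
  moreover have "nonneg_coeffs 2"
    using nonneg_coeffs_of_int[of 2] by simp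
  ultimately show ?thesis
    unfolding c(1) gamma_sum_def
    by (simp add: pcompose_sum pcompose_mult pcompose_power pcompose_add pcompose_var)
      (intro nonneg_coeffs_sum nonneg_coeffs_mult nonneg_coeffs_power nonneg_coeffs_add
        nonneg_coeffs_of_int nonneg_coeffs_vars c(2))
qed

lemma F_poly_eq_pcompose: "F_poly P = pcompose (H_poly P) (alpha_var + t_var)"
proof -
  have "pcompose (alpha_var - t_var) (alpha_var + t_var) = alpha_var"
    by (simp add: pcompose_diff pcompose_var)
  then show ?thesis
    unfolding H_poly_def pcompose_assoc[symmetric] by (simp add: alpha_var_def pcompose_idR)
qed

lemma f_num_eq_coeff:
  assumes "i \<le> poly_dim P"
  shows "int (f_num P i) = coeff (coeff (F_poly P) i) (poly_dim P - i)"
proof -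
  have "coeff (coeff (F_poly P) i) (poly_dim P - i) = (\<Sum>j\<le>poly_dim P.
      int (f_num P j) * coeff (coeff (alpha_var ^ j * t_var ^ (poly_dim P - j)) i) (poly_dim P - i))"
    by (simp add: F_poly_def coeff_sum of_nat_poly mult.assoc)
  also have "\<dots> = (\<Sum>j\<le>poly_dim P. if j = i then int (f_num P j) else 0)"
    by (rule sum.cong[OF refl]) (simp add: coeff_alpha_t)
  also have "\<dots> = int (f_num P i)"
    using assms by simp
  finally show ?thesis ..
qed

text \<open>
  The coefficients in the basis $(\alpha t)^i(\alpha + t)^{n-2i}$ are unique, so they are the $\gamma_i$,
  and the other numbers depend monotonically on them. For $g_k$ this is the growth of
  binomial coefficients up to the middle: $k - i \le (n - 2i)/2$ if $k \le n/2$.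
\<close>

theorem gamma_cone_comparison:
  assumes dim: "poly_dim P = n" "poly_dim Q = n"
    and P: "H_poly P \<in> gamma_cone n" and diff: "H_poly Q - H_poly P \<in> gamma_cone n"
  shows "gamma_num P i \<le> gamma_num Q i"
    and "i \<le> n div 2 \<Longrightarrow> g_num P i \<le> g_num Q i"
    and "i \<le> n \<Longrightarrow> h_num P i \<le> h_num Q i"
    and "i \<le> n \<Longrightarrow> f_num P i \<le> f_num Q i"
proof -
  obtain c where c: "H_poly P = gamma_sum n c" "\<And>i. 0 \<le> c i" "\<And>i. i > n div 2 \<Longrightarrow> c i = 0"
    using P unfolding gamma_cone_def by blast
  obtain d where d: "H_poly Q - H_poly P = gamma_sum n d" "\<And>i. 0 \<le> d i" "\<And>i. i > n div 2 \<Longrightarrow> d i = 0"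
    using diff unfolding gamma_cone_def by blast
  have "H_poly Q = gamma_sum n c + gamma_sum n d"
    using c(1) d(1) by (simp add: algebra_simps)
  also have "\<dots> = gamma_sum n (\<lambda>i. c i + d i)"
    by (simp add: gamma_sum_def sum.distrib algebra_simps)
  finally have Q: "H_poly Q = gamma_sum n (\<lambda>i. c i + d i)" .
  show "gamma_num P i \<le> gamma_num Q i"
    using gamma_num_eq[of P c] gamma_num_eq[of Q "\<lambda>i. c i + d i"] c d Q dim by simp
  have hP: "h_num P k = (\<Sum>i\<le>n div 2. c i * (if i \<le> k then int ((n - 2 * i) choose (k - i)) else 0))"
    if "k \<le> n" for k
    unfolding h_num_def c(1) dim(1) by (rule coeff_gamma_sum[OF that])
  have hQ: "h_num Q k = (\<Sum>i\<le>n div 2. (c i + d i) * (if i \<le> k then int ((n - 2 * i) choose (k - i)) else 0))"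
    if "k \<le> n" for k
    unfolding h_num_def Q dim(2) by (rule coeff_gamma_sum[OF that])
  have hd: "h_num Q k - h_num P k = (\<Sum>i\<le>n div 2. d i * (if i \<le> k then int ((n - 2 * i) choose (k - i)) else 0))"
    if "k \<le> n" for k
    unfolding hP[OF that] hQ[OF that] by (simp add: sum_subtractf[symmetric] algebra_simps)
  show "h_num P i \<le> h_num Q i" if "i \<le> n"
  proof -
    have "0 \<le> h_num Q i - h_num P i"
      unfolding hd[OF that] using d(2) by (intro sum_nonneg) simp
    then show ?thesis by simp
  qed
  show "g_num P i \<le> g_num Q i" if "i \<le> n div 2"
  proof (cases i)
    case (Suc k)
    have le: "Suc k \<le> n" "k \<le> n" using that Suc by linarith+
    have "(\<Sum>i\<le>n div 2. d i * (if i \<le> k then int ((n - 2 * i) choose (k - i)) else 0)) \<le>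
        (\<Sum>i\<le>n div 2. d i * (if i \<le> Suc k then int ((n - 2 * i) choose (Suc k - i)) else 0))"
    proof (intro sum_mono mult_left_mono d(2))
      fix j assume "j \<in> {..n div 2}"
      have "(n - 2 * j) choose (k - j) \<le> (n - 2 * j) choose (Suc k - j)" if "j \<le> k"
        using that \<open>i \<le> n div 2\<close> Suc by (intro binomial_mono) auto
      then show "(if j \<le> k then int ((n - 2 * j) choose (k - j)) else 0) \<le>
          (if j \<le> Suc k then int ((n - 2 * j) choose (Suc k - j)) else 0)"
        by auto
    qed
    then have "h_num Q k - h_num P k \<le> h_num Q (Suc k) - h_num P (Suc k)"
      unfolding hd[OF le(1)] hd[OF le(2)] .
    then show ?thesis
      by (simp add: g_num_def Suc)
  qed (simp add: g_num_def)
  show "f_num P i \<le> f_num Q i" if "i \<le> n"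
  proof -
    have "nonneg_coeffs (F_poly Q - F_poly P)"
      using nonneg_coeffs_pcompose_gamma_cone[OF diff] by (simp add: F_poly_eq_pcompose pcompose_diff)
    then have "0 \<le> coeff (coeff (F_poly Q) i) (n - i) - coeff (coeff (F_poly P) i) (n - i)"
      unfolding nonneg_coeffs_def coeff_diff by blast
    then show ?thesis
      using f_num_eq_coeff[of i P] f_num_eq_coeff[of i Q] that dim by simp
  qed
qed

section \<open>The bounds\<close>

lemma graph_associahedron_eq:
  assumes "sym (parcs G)" "pverts G = UNIV"
  shows "graph_associahedron G = graph_polytope (parcs G)"
proof -
  have "graphical_building_set G = {S. conn (parcs G) S}"
    using assms connected_induce_iff_conn[OF assms(1)] conn_nonempty
    by (auto simp: graphical_building_set_def)
  then show ?thesis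
    by (simp add: graph_associahedron_def graph_polytope_def)
qed

theorem theorem5:
  fixes \<Gamma> :: "'v::{finite,linorder} pair_pre_digraph" and n :: nat
  assumes "n \<ge> 1"
    and "CARD('v) = n + 1"
    and "pair_graph \<Gamma>"
    and "pverts \<Gamma> = UNIV"
    and "Digraph_Component.connected (with_proj \<Gamma>)"
  shows "(\<forall>i \<le> n div 2.
            gamma_num (associahedron :: (real, 'v) vec set) i \<le> gamma_num (graph_associahedron \<Gamma>) i \<and>
            gamma_num (graph_associahedron \<Gamma>) i \<le> gamma_num (permutohedron :: (real, 'v) vec set) i) \<and>
         (\<forall>i \<le> n div 2.
            g_num (associahedron :: (real, 'v) vec set) i \<le> g_num (graph_associahedron \<Gamma>) i \<and>
            g_num (graph_associahedron \<Gamma>) i \<le> g_num (permutohedron :: (real, 'v) vec set) i) \<and>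
         (\<forall>i \<le> n.
            h_num (associahedron :: (real, 'v) vec set) i \<le> h_num (graph_associahedron \<Gamma>) i \<and>
            h_num (graph_associahedron \<Gamma>) i \<le> h_num (permutohedron :: (real, 'v) vec set) i) \<and>
         (\<forall>i \<le> n.
            f_num (associahedron :: (real, 'v) vec set) i \<le> f_num (graph_associahedron \<Gamma>) i \<and>
            f_num (graph_associahedron \<Gamma>) i \<le> f_num (permutohedron :: (real, 'v) vec set) i)"
proof -
  let ?E = "parcs \<Gamma>"
  let ?L = "parcs (path_graph :: 'v pair_pre_digraph)"
  let ?K = "parcs (complete_graph :: 'v pair_pre_digraph)"
  interpret pair_graph \<Gamma> by fact
  have symE: "sym ?E"
    using pair_sym_arcs by (simp add: symmetric_def)
  have irreflE: "irrefl ?E"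
    using pair_no_loops by (force simp: irrefl_def)
  have "with_proj \<Gamma> \<restriction> UNIV = with_proj \<Gamma>"
    using assms(4) by (simp add: induce_subgraph_def with_proj_def)
  then have connE: "conn ?E UNIV"
    using assms(5) connected_induce_iff_conn[OF symE, of UNIV] by simp
  have symL: "sym ?L"
    by (auto simp: path_graph_def sym_def)
  have pathL: "is_path ?L UNIV"
    by (auto simp: path_graph_def is_path_def consecutive_def)
  have L: "conn ?L UNIV" "hpoly ?L UNIV = path_h (n + 1)"
    using hpoly_path[OF symL pathL] assms(2) by simp_all
  have symK: "sym ?K" and irreflK: "irrefl ?K"
    by (auto simp: complete_graph_def sym_def irrefl_def)
  have EK: "?E \<subseteq> ?K"
    using irreflE by (auto simp: complete_graph_def irrefl_def)
  have connK: "conn ?K UNIV"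
    using connE EK by (rule conn_mono)
  have eqs: "associahedron = graph_polytope ?L" "permutohedron = graph_polytope ?K"
    "graph_associahedron \<Gamma> = graph_polytope ?E"
    using graph_associahedron_eq[OF symL] graph_associahedron_eq[OF symK]
      graph_associahedron_eq[OF symE assms(4)]
    by (simp_all add: associahedron_def permutohedron_def path_graph_def complete_graph_def)
  have dims: "poly_dim (graph_polytope ?L) = n" "poly_dim (graph_polytope ?K) = n"
    "poly_dim (graph_polytope ?E) = n"
    using poly_dim_graph_polytope[OF L(1)] poly_dim_graph_polytope[OF connK]
      poly_dim_graph_polytope[OF connE] assms(2) by simp_all
  have "H_poly (graph_polytope ?L) \<in> gamma_cone n"
    using path_h_gamma[of "n + 1"] by (simp add: H_poly_graph_polytope[OF L(1)] L(2))
  moreover have "H_poly (graph_polytope ?E) - H_poly (graph_polytope ?L) \<in> gamma_cone n"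
    using hpoly_ge_path[OF symE irreflE connE] assms(2)
    by (simp add: H_poly_graph_polytope[OF L(1)] H_poly_graph_polytope[OF connE] L(2))
  moreover have "H_poly (graph_polytope ?E) \<in> gamma_cone n"
    using hpoly_gamma[OF symE irreflE connE] assms(2) by (simp add: H_poly_graph_polytope[OF connE])
  moreover have "H_poly (graph_polytope ?K) - H_poly (graph_polytope ?E) \<in> gamma_cone n"
    using hpoly_mono[OF symE symK irreflK EK connE] assms(2)
    by (simp add: H_poly_graph_polytope[OF connE] H_poly_graph_polytope[OF connK])
  ultimately show ?thesis
    unfolding eqs
    using gamma_cone_comparison[OF dims(1,3)] gamma_cone_comparison[OF dims(3,2)] by simp
qed

end
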